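(* For every polynomial $p:\mathbb{N}\to\mathbb{N}$ and integers $a,r\ge 1$, there exists a polynomial $q':\mathbb{N}\to\mathbb{N}$ such that the following holds. Let $G$ be an $n$-vertex graph with expansion bounded by $p$. For every integer $t\ge 1$, there exists a set $Z\subseteq V(G)$ of size at most $\exp(q'(t))\log^{(a)} n$ such that $G-Z$ has a balanced distance-$r$ separator of size at most $n/t$.
   Context: A depth-$\ell$ minor of a graph $G$ is a graph obtained from a subgraph of $G$ by contracting pairwise vertex-disjoint connected subgraphs, each of radius at most $\ell$; $\nabla_\ell(G)$ is the maximum of $|E(H)|/|V(H)|$ over depth-$\ell$ minors $H$ of $G$; the expansion of $G$ is bounded by $f$ if $\nabla_\ell(G)\le f(\ell)$ for all integers $\ell\ge 0$. For an integer $r\ge 1$, a set $C\subseteq V(H)$ is a balanced distance-$r$ separator in a graph $H$ if $V(H-C)=A\cup B$ for disjoint sets $A,B$ with $|A|,|B|\le\tfrac{2}{3}|V(H)|$ and the distance $d_H(A,B)$ between $A$ and $B$ in $H$ is greater than $r$. Iterated logarithm: $\log^{(0)}(x)=x$, $\log^{(i+1)}(x)=\log_2\max(2,\log^{(i)}(x))$. *)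

theory Defs
  imports
    "HOL-Computational_Algebra.Polynomial"
    "Graph_Theory.Digraph_Component"
    "Graph_Theory.Shortest_Path"
begin

(* Finite simple undirected graphs are those satisfying the locale predicate graph: finite
   digraphs without loops or parallel arcs whose arc relation is symmetric.  Every undirected
   edge is therefore represented by two opposite arcs. *)

(* The coefficients are real, so that integer-valued polynomials such as x(x+1)/2 are covered. *)
definition polynomial_fun :: "(nat \<Rightarrow> nat) \<Rightarrow> bool" where
  "polynomial_fun f \<longleftrightarrow> (\<exists>P :: real poly. \<forall>x. real (f x) = poly P (real x))"

primrec iter_log :: "nat \<Rightarrow> real \<Rightarrow> real" where
  "iter_log 0 x = x"
| "iter_log (Suc i) x = log 2 (max 2 (iter_log i x))"

(* Infinite if v is not reachable from u. *)
definition graph_dist :: "('a, 'b) pre_digraph \<Rightarrow> 'a \<Rightarrow> 'a \<Rightarrow> ereal" where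
  "graph_dist G u v = wf_digraph.\<mu> G (\<lambda>_. 1) u v"

(* Infinite if A or B is empty. *)
definition graph_setdist :: "('a, 'b) pre_digraph \<Rightarrow> 'a set \<Rightarrow> 'a set \<Rightarrow> ereal" where
  "graph_setdist G A B = (INF u\<in>A. INF v\<in>B. graph_dist G u v)"

definition graph_radius :: "('a, 'b) pre_digraph \<Rightarrow> ereal" where
  "graph_radius G = (INF c\<in>verts G. SUP v\<in>verts G. graph_dist G c v)"

(* Vertices of the contraction are represented by the vertex sets they arise from; a vertex v of S
   outside all members of F survives as {v}.  Loops and multiplicities are discarded. *)
definition contract ::
  "('a, 'b) pre_digraph \<Rightarrow> ('a, 'b) pre_digraph set \<Rightarrow> 'a set pair_pre_digraph" where
  "contract S F =
    (let P = verts ` F \<union> (\<lambda>v. {v}) ` (verts S - (\<Union>K\<in>F. verts K))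
     in \<lparr> pverts = P,
          parcs = {(X, Y). X \<in> P \<and> Y \<in> P \<and> X \<noteq> Y \<and> (\<exists>u\<in>X. \<exists>v\<in>Y. u \<rightarrow>\<^bsub>S\<^esub> v)} \<rparr>)"

(* Connected graphs are nonempty in the library. The qualified name avoids topological
   connectedness. *)
definition depth_minor ::
  "nat \<Rightarrow> ('a, 'b) pre_digraph \<Rightarrow> 'a set pair_pre_digraph \<Rightarrow> bool" where
  "depth_minor l G H \<longleftrightarrow>
    (\<exists>S F. graph S \<and> subgraph S G \<and>
      (\<forall>K\<in>F. graph K \<and> subgraph K S \<and> Digraph_Component.connected K \<and>
        graph_radius K \<le> ereal (real l)) \<and>
      pairwise (\<lambda>K L. disjnt (verts K) (verts L)) F \<and>
      H = contract S F)"

definition edge_density :: "'a pair_pre_digraph \<Rightarrow> real" where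
  "edge_density H = (real (card (parcs H)) / 2) / real (card (pverts H))"

(* The null graph is among the minors but contributes only 0 / 0 = 0. *)
definition nabla :: "nat \<Rightarrow> ('a, 'b) pre_digraph \<Rightarrow> real" where
  "nabla l G = Max (edge_density ` {H. depth_minor l G H})"

definition expansion_bounded :: "('a, 'b) pre_digraph \<Rightarrow> (nat \<Rightarrow> real) \<Rightarrow> bool" where
  "expansion_bounded G f \<longleftrightarrow> (\<forall>l. nabla l G \<le> f l)"

abbreviation delete_verts ::
  "('a, 'b) pre_digraph \<Rightarrow> 'a set \<Rightarrow> ('a, 'b) pre_digraph" where
  "delete_verts G Z \<equiv> G \<restriction> (verts G - Z)"

(* The distance is measured in H itself, not in H - C. *)
definition balanced_dist_separator ::
  "nat \<Rightarrow> ('a, 'b) pre_digraph \<Rightarrow> 'a set \<Rightarrow> bool" where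
  "balanced_dist_separator r H C \<longleftrightarrow>
    C \<subseteq> verts H \<and>
    (\<exists>A B. verts (delete_verts H C) = A \<union> B \<and> A \<inter> B = {} \<and>
      real (card A) \<le> 2 / 3 * real (card (verts H)) \<and>
      real (card B) \<le> 2 / 3 * real (card (verts H)) \<and>
      graph_setdist H A B > ereal (real r))"

end

theory Submission
  imports Defs
begin

text \<open>
  Start from a set \<open>Z\<close> of exceptional vertices whose deletion leaves a balanced distance-\<open>r\<close> separation
  (initially \<open>Z = V\<close>) and replace it by one whose size is polynomial in \<open>t log |Z|\<close>, in the spirit of
  Plotkin, Rao and Smith: maintain pairwise adjacent bags of small radius, forming a clique minor, and
  grow balls of thickness-\<open>r\<close> layers, around a remaining exceptional vertex and around a bag. If the
  vertex reaches every bag, it yields a new bag; otherwise one of two disjoint balls contains at most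
  half of what remains and can be split off at a sparse layer. Each split is paid for by the size of the
  ball together with a charge \<open>|V| / |Z|\<close> for its centre, so a sparse layer appears after
  \<open>O(t log |Z|)\<close> layers. Bounded expansion limits the number of bags, and the union of the bags is the
  new exceptional set. Distances are measured in the graph without the bags, not in the part
  that remains, which is why the argument needs no degree condition for \<open>r > 1\<close>. After \<open>a + 1\<close> rounds
  the size is polynomial in the \<open>(a + 1)\<close>-fold iterated logarithm.
\<close>

section \<open>Neighbourhoods inside a vertex set\<close>

text \<open>The ball of radius \<open>k\<close> about \<open>A\<close> in the subgraph induced on
  \<open>U\<close>. Sources outside \<open>U\<close> are dropped at the start, so the set of all
  neighbours of some \<open>W\<close> can serve as a source.\<close>

primrec nbhd :: "'a rel \<Rightarrow> 'a set \<Rightarrow> nat \<Rightarrow> 'a set \<Rightarrow> 'a set" where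
  "nbhd E U 0 A = A \<inter> U"
| "nbhd E U (Suc k) A = nbhd E U k A \<union> (E `` nbhd E U k A \<inter> U)"

lemma nbhd_subset: "nbhd E U k A \<subseteq> U"
  by (induction k) auto

lemma nbhd_base: "A \<inter> U \<subseteq> nbhd E U k A"
  by (induction k) auto

lemma nbhd_mono:
  assumes "U \<subseteq> U'" "j \<le> k" "A \<subseteq> A'"
  shows "nbhd E U j A \<subseteq> nbhd E U' k A'"
proof -
  have "nbhd E U j A \<subseteq> nbhd E U' j A'"
    by (induction j) (use assms in auto)
  also have "\<dots> \<subseteq> nbhd E U' k A'"
    using assms(2) by (rule lift_Suc_mono_le[rotated]) auto
  finally show ?thesis .
qed

lemma nbhd_add: "nbhd E U (j + k) A = nbhd E U k (nbhd E U j A)"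
proof (induction k)
  case 0
  show ?case using nbhd_subset[of E U j A] by auto
qed simp

lemma nbhd_Un: "nbhd E U k (A \<union> B) = nbhd E U k A \<union> nbhd E U k B"
  by (induction k) auto

lemma nbhd_eq_UN: "nbhd E U k A = (\<Union>x\<in>A. nbhd E U k {x})"
proof (induction k)
  case (Suc k)
  have "E `` nbhd E U k A = (\<Union>x\<in>A. E `` nbhd E U k {x})"
    by (subst Suc.IH) (simp add: Image_UN)
  then show ?case by (simp add: Suc.IH) blast
qed auto

lemma nbhd_sym:
  assumes "sym E" "y \<in> nbhd E U k {x}"
  shows "x \<in> nbhd E U k {y}"
  using assms(2)
proof (induction k arbitrary: y)
  case (Suc k)
  show ?case
  proof (cases "y \<in> nbhd E U k {x}")
    case True
    then show ?thesis using Suc.IH by auto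
  next
    case False
    then obtain u where u: "u \<in> nbhd E U k {x}" "(u, y) \<in> E" "y \<in> U"
      using Suc.prems by auto
    have "u \<in> U" using u(1) nbhd_subset[of E U k] by auto
    then have "u \<in> nbhd E U 1 {y}"
      using u assms(1) by (auto dest: symD)
    then have "nbhd E U k {u} \<subseteq> nbhd E U (1 + k) {y}"
      unfolding nbhd_add by (intro nbhd_mono) auto
    then show ?thesis using Suc.IH[OF u(1)] by auto
  qed
qed auto

text \<open>A walk that never meets \<open>W\<close> stays in \<open>U\<close>; otherwise, from a
  meeting on, it is a walk from \<open>W\<close> that is no longer.\<close>

lemma nbhd_Un_verts: "nbhd E (U \<union> W) k A \<subseteq> nbhd E U k A \<union> nbhd E (U \<union> W) k W"
proof (induction k)
  case (Suc k)
  then show ?case using nbhd_base[of W "U \<union> W" E k] by auto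
qed auto

text \<open>Cut a walk after its last visit to \<open>W\<close>: the next vertex is a neighbour of
  \<open>W\<close> and the rest runs in \<open>U\<close>.\<close>

lemma nbhd_leave: "nbhd E (U \<union> W) k W \<subseteq> W \<union> nbhd E U k (E `` W)"
proof (induction k)
  case (Suc k)
  then show ?case using nbhd_base[of "E `` W" U E k] by auto
qed auto

text \<open>\<open>P\<close> is the vertex set of a walk, so its vertices are reached from
  \<open>x\<close> inside \<open>P\<close> itself; a bag united from such sets has small radius of
  its own.\<close>

lemma nbhd_path:
  assumes "y \<in> nbhd E U k {x}"
  obtains P where "finite P" "P \<subseteq> U" "x \<in> P" "y \<in> P" "card P \<le> Suc k" "P \<subseteq> nbhd E P k {x}"
proof -
  have "\<exists>P. finite P \<and> P \<subseteq> U \<and> x \<in> P \<and> y \<in> P \<and> card P \<le> Suc k \<and> P \<subseteq> nbhd E P k {x}"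
    using assms
  proof (induction k arbitrary: y)
    case 0
    then show ?case by (intro exI[of _ "{x}"]) auto
  next
    case (Suc k)
    show ?case
    proof (cases "y \<in> nbhd E U k {x}")
      case True
      from Suc.IH[OF this] obtain P where P: "finite P" "P \<subseteq> U" "x \<in> P" "y \<in> P"
        "card P \<le> Suc k" "P \<subseteq> nbhd E P k {x}" by auto
      then show ?thesis by (intro exI[of _ P]) auto
    next
      case False
      then obtain u where u: "u \<in> nbhd E U k {x}" "(u, y) \<in> E" "y \<in> U"
        using Suc.prems by auto
      from Suc.IH[OF u(1)] obtain P where P: "finite P" "P \<subseteq> U" "x \<in> P" "u \<in> P"
        "card P \<le> Suc k" "P \<subseteq> nbhd E P k {x}" by auto
      have "P \<subseteq> nbhd E (insert y P) k {x}"
        using P(6) nbhd_mono[of P "insert y P" k k "{x}" "{x}" E] by auto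
      moreover from this have "y \<in> nbhd E (insert y P) (Suc k) {x}"
        using P(4) u(2) by auto
      ultimately have "insert y P \<subseteq> nbhd E (insert y P) (Suc k) {x}"
        by auto
      then show ?thesis
        using P u by (intro exI[of _ "insert y P"]) (auto simp: card_insert_if)
    qed
  qed
  then show thesis using that by blast
qed

section \<open>Clique minor models and distance separations\<close>

text \<open>A clique minor given by its branch sets. The ball is taken inside \<open>M\<close>, so
  the centre \<open>z\<close> witnesses connectedness and radius of the induced subgraph; it also
  makes every bag nonempty.\<close>

definition clique_model :: "'a rel \<Rightarrow> 'a set \<Rightarrow> nat \<Rightarrow> 'a set set \<Rightarrow> bool" where
  "clique_model E V D \<M> \<longleftrightarrow>
    (\<forall>M\<in>\<M>. M \<subseteq> V \<and> (\<exists>z\<in>M. M \<subseteq> nbhd E M D {z})) \<and>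
    (\<forall>M\<in>\<M>. \<forall>L\<in>\<M>. M \<noteq> L \<longrightarrow> M \<inter> L = {} \<and> E `` M \<inter> L \<noteq> {})"

lemma clique_model_subset:
  assumes "clique_model E V D \<M>" "\<M>' \<subseteq> \<M>"
  shows "clique_model E V D \<M>'"
  unfolding clique_model_def
proof (intro conjI ballI impI)
  fix M assume "M \<in> \<M>'"
  then have M: "M \<in> \<M>" using assms(2) by blast
  then show "M \<subseteq> V" "\<exists>z\<in>M. M \<subseteq> nbhd E M D {z}"
    using assms(1) by (simp_all add: clique_model_def)
  fix L assume "L \<in> \<M>'" "M \<noteq> L"
  then have "L \<in> \<M>" "M \<noteq> L" using assms(2) by blast+
  then show "M \<inter> L = {}" "E `` M \<inter> L \<noteq> {}"
    using assms(1) M by (simp_all add: clique_model_def)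
qed

text \<open>The distance between \<open>A\<close> and \<open>B\<close> is measured without \<open>Z\<close> but through \<open>X\<close>, and balance is
  relative to all of \<open>V\<close>, including \<open>Z\<close>.\<close>

definition dist_separation ::
  "'a rel \<Rightarrow> 'a set \<Rightarrow> nat \<Rightarrow> 'a set \<Rightarrow> 'a set \<Rightarrow> 'a set \<Rightarrow> 'a set \<Rightarrow> bool" where
  "dist_separation E V r Z X A B \<longleftrightarrow>
    Z \<subseteq> V \<and> X \<subseteq> V \<and> A \<union> B = V - Z - X \<and> A \<inter> B = {} \<and>
    3 * card A \<le> 2 * card V \<and> 3 * card B \<le> 2 * card V \<and>
    nbhd E (V - Z) r A \<inter> B = {}"

lemma dist_separation_commute:
  assumes "sym E" "dist_separation E V r Z X A B"
  shows "dist_separation E V r Z X B A"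
proof -
  have "nbhd E (V - Z) r B \<inter> A = {}"
  proof (rule ccontr)
    assume "\<not> ?thesis"
    then obtain x y where xy: "x \<in> B" "y \<in> A" "y \<in> nbhd E (V - Z) r {x}"
      using nbhd_eq_UN[of E "V - Z" r B] by auto
    then have "x \<in> nbhd E (V - Z) r A"
      using nbhd_sym[OF assms(1) xy(3)] nbhd_eq_UN[of E "V - Z" r A] by blast
    then show False using xy assms(2) by (auto simp: dist_separation_def)
  qed
  then show ?thesis using assms(2) by (auto simp: dist_separation_def)
qed

text \<open>If every step grew fast, \<open>n + Q * f i\<close> would gain a factor
  \<open>1 + 1 / N\<close> per step, hence by Bernoulli's inequality double every \<open>N\<close>
  steps and exceed \<open>2 * Q * n\<close> after \<open>N * m\<close> steps; but it ends at most at
  \<open>n + Q * n\<close>. The summand \<open>n\<close> is the charge of the centre.\<close>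

lemma slow_growth_step:
  fixes f :: "nat \<Rightarrow> nat" and n N m Q :: nat
  assumes "f (N * m) \<le> n" "n > 0" "N > 0" "2 * Q < 2 ^ m" "Q > 0"
  shows "\<exists>i<N * m. N * Q * (f (Suc i) - f i) \<le> n + Q * f i"
proof (rule ccontr)
  assume "\<not> ?thesis"
  then have fast: "n + Q * f i < N * Q * (f (Suc i) - f i)" if "i < N * m" for i
    using that by (meson not_le_imp_less)
  define g where "g i = real n + real Q * real (f i)" for i
  have step: "(1 + 1 / real N) * g i \<le> g (Suc i)" if "i < N * m" for i
  proof -
    \<comment> \<open>Subtraction truncates at 0; strictness makes the difference a true
      one.\<close>
    have pos: "f (Suc i) - f i > 0"
      using fast[OF that] by (cases "f (Suc i) - f i") auto
    have "real (n + Q * f i) < real (N * Q * (f (Suc i) - f i))"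
      using fast[OF that] by (simp only: of_nat_less_iff)
    also have "\<dots> = real N * real Q * (real (f (Suc i)) - real (f i))"
      using pos by (simp add: of_nat_diff)
    also have "\<dots> = real N * (g (Suc i) - g i)"
      by (simp add: g_def algebra_simps)
    finally have "g i \<le> real N * (g (Suc i) - g i)"
      by (simp add: g_def)
    then show ?thesis using \<open>N > 0\<close> by (simp add: field_simps)
  qed
  have pow: "(1 + 1 / real N) ^ i * g 0 \<le> g i" if "i \<le> N * m" for i
    using that
  proof (induction i)
    case (Suc i)
    have "(1 + 1 / real N) ^ Suc i * g 0 \<le> (1 + 1 / real N) * g i"
      using Suc by (simp add: mult.assoc mult_left_mono)
    then show ?case using step[of i] Suc.prems by simp
  qed simp
  have "2 \<le> (1 + 1 / real N) ^ N"
    using Bernoulli_inequality[of "1 / real N" N] \<open>N > 0\<close> order.trans[of "- 1" 0 "1 / real N"]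
    by simp
  then have "2 ^ m \<le> ((1 + 1 / real N) ^ N) ^ m"
    by (intro power_mono) auto
  then have "2 ^ m * real n \<le> (1 + 1 / real N) ^ (N * m) * g 0"
    by (intro mult_mono) (auto simp: power_mult g_def)
  also have "\<dots> \<le> g (N * m)" by (rule pow) simp
  also have "\<dots> \<le> real (n + Q * n)"
    using assms(1) by (simp add: g_def mult_left_mono)
  also have "\<dots> \<le> real (2 * Q * n)"
    using \<open>Q > 0\<close> by (intro of_nat_mono) (cases Q, auto)
  finally have "real (2 ^ m * n) \<le> real (2 * Q * n)" by simp
  then have "2 ^ m * n \<le> 2 * Q * n" by (simp only: of_nat_le_iff)
  then show False using assms(2,4) by auto
qed

section \<open>Shrinking the exceptional set\<close>

text \<open>One round: \<open>Q\<close> bounds the exceptional set, \<open>1 / N\<close> governs the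
  density of a cut layer, \<open>N * m\<close> layers of thickness \<open>r\<close> suffice for a
  sparse one to appear, and \<open>h\<close> bounds the number of bags.\<close>

locale separation_refinement =
  fixes E :: "'a rel" and V Z X A B :: "'a set" and r h N m Q :: nat
  assumes finite_V: "finite V" and V_ne: "V \<noteq> {}" and sym_E: "sym E"
    and sep: "dist_separation E V r Z X A B"
    and card_Z: "card Z \<le> Q" and Q_pos: "Q > 0" and N_pos: "N > 0" and m: "2 * Q < 2 ^ m"
    and models: "\<And>\<M>. clique_model E V (2 * (r * (N * m))) \<M> \<Longrightarrow> card \<M> \<le> h"
begin

text \<open>Twice the radius of a ball of \<open>N * m\<close> layers: the balls about a vertex and
  a bag meet in \<open>R\<close> only if a neighbour of the bag is within this distance of the
  vertex.\<close>

definition D :: nat where "D = 2 * (r * (N * m))"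

text \<open>A state consists of the bags \<open>\<M>\<close>, the part \<open>R\<close> still to be separated and the layers \<open>Y\<close> removed so
  far. Exceptional vertices may well lie in \<open>Y\<close>; what matters is only whether they are near \<open>R\<close>.
  The last condition of a state bounds \<open>Y\<close> by a potential, cleared of denominators, in which every
  near exceptional vertex and every bag (as a future centre of a ball) still holds its charge
  \<open>|V| / Q\<close>.\<close>

definition near :: "'a set set \<Rightarrow> 'a set \<Rightarrow> 'a set" where
  "near \<M> R = Z \<inter> nbhd E (V - \<Union>\<M>) r R"

text \<open>All pieces split off so far form one side; only their distance to \<open>R\<close>
  matters, never the distances among them.\<close>

definition far :: "'a set set \<Rightarrow> 'a set \<Rightarrow> 'a set \<Rightarrow> 'a set" where
  "far \<M> R Y = V - \<Union>\<M> - Y - R"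

definition state :: "'a set set \<Rightarrow> 'a set \<Rightarrow> 'a set \<Rightarrow> bool" where
  "state \<M> R Y \<longleftrightarrow>
    clique_model E V D \<M> \<and> (\<forall>M\<in>\<M>. card M \<le> h * Suc D + 1) \<and>
    R \<subseteq> V - \<Union>\<M> \<and> Y \<subseteq> V \<and>
    nbhd E (V - \<Union>\<M>) r (far \<M> R Y) \<inter> R = {} \<and>
    3 * card (far \<M> R Y) \<le> 2 * card V \<and>
    N * Q * card Y + Q * card R + card V * (card (near \<M> R) + card \<M>) \<le> 2 * card V * Q"

text \<open>The weight 2 makes the rank drop even when an exceptional vertex becomes part of a new bag.\<close>

definition rank :: "'a set set \<Rightarrow> 'a set \<Rightarrow> nat" where
  "rank \<M> R = 2 * card (near \<M> R) + card \<M>"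

lemma finite_model: "clique_model E V k \<M> \<Longrightarrow> finite \<M>"
  using finite_V by (auto simp: clique_model_def intro: finite_subset[of \<M> "Pow V"])

lemma Z_subset: "Z \<subseteq> V"
  using sep by (simp add: dist_separation_def)

lemma finite_near: "finite (near \<M> R)"
  using Z_subset finite_V by (auto simp: near_def intro: finite_subset)

text \<open>Covers both balls around a vertex, with \<open>\<M>' = \<M>\<close>, and balls around a bag, which is then dissolved.\<close>

lemma cut:
  assumes st: "state \<M> R Y" and sub: "\<M>' \<subseteq> \<M>"
    and S: "\<Union>\<M> - \<Union>\<M>' \<subseteq> S" "S \<subseteq> V - \<Union>\<M>'"
    and half: "2 * card (R \<inter> nbhd E (V - \<Union>\<M>') (r * (N * m)) S) \<le> card R"
    and big: "2 * card V < 3 * card R"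
    and progress: "card \<M>' < card \<M> \<or> S \<inter> near \<M> R \<noteq> {}"
  shows "\<exists>R' Y'. state \<M>' R' Y' \<and> rank \<M>' R' < rank \<M> R"
proof -
  define U where "U = V - \<Union>\<M>"
  define U' where "U' = V - \<Union>\<M>'"
  define W where "W = \<Union>\<M> - \<Union>\<M>'"
  define b where "b i = nbhd E U' (r * i) S" for i
  have model: "clique_model E V D \<M>" and R: "R \<subseteq> U" and Y: "Y \<subseteq> V"
    and sepR: "nbhd E U r (far \<M> R Y) \<inter> R = {}"
    and pot: "N * Q * card Y + Q * card R + card V * (card (near \<M> R) + card \<M>) \<le> 2 * card V * Q"
    using st by (auto simp: state_def U_def)
  have "\<Union>\<M> \<subseteq> V" using model by (auto simp: clique_model_def)
  then have U': "U' = U \<union> W" using sub by (auto simp: U'_def U_def W_def)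
  have W: "W \<subseteq> S" using S by (simp add: W_def)
  have SU': "S \<subseteq> U'" using S by (simp add: U'_def)
  have fin: "finite R" "finite Y" using R Y finite_V by (auto simp: U_def intro: finite_subset)
  have "card V > 0" using finite_V V_ne by (simp add: card_gt_0_iff)
  moreover have "card (R \<inter> b (N * m)) \<le> card V"
    using R finite_V by (intro card_mono) (auto simp: U_def)
  \<comment> \<open>Growth is measured by the trace on \<open>R\<close>, since only vertices leaving
    \<open>R\<close> pay for a cut.\<close>
  ultimately obtain i where i: "i < N * m"
    "N * Q * (card (R \<inter> b (Suc i)) - card (R \<inter> b i)) \<le> card V + Q * card (R \<inter> b i)"
    using slow_growth_step[of "\<lambda>i. card (R \<inter> b i)" N m "card V" Q] N_pos Q_pos m by blast
  have b_Suc: "b (Suc i) = nbhd E U' r (b i)"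
    by (simp add: b_def nbhd_add[symmetric] add.commute)
  have S_b: "S \<subseteq> b j" for j using nbhd_base[of S U' E] SU' by (auto simp: b_def)
  have b_mono: "b j \<subseteq> b k" if "j \<le> k" for j k
    unfolding b_def using that by (intro nbhd_mono) auto
  have nb_S: "nbhd E U' r S \<subseteq> b (Suc i)"
    unfolding b_Suc by (intro nbhd_mono S_b) auto
  have nb_W: "nbhd E U' r W \<subseteq> b (Suc i)"
    using nb_S nbhd_mono[of U' U' r r W S E] W by auto
  define R' where "R' = R - b (Suc i)"
  define L where "L = R \<inter> b (Suc i) - R \<inter> b i"
  define Y' where "Y' = Y \<union> L"
  have card_L: "card L = card (R \<inter> b (Suc i)) - card (R \<inter> b i)"
    unfolding L_def using fin b_mono[of i "Suc i"] by (intro card_Diff_subset) auto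
  have card_R: "card R = card R' + card L + card (R \<inter> b i)"
  proof -
    have "R = R' \<union> (L \<union> R \<inter> b i)" using b_mono[of i "Suc i"] by (auto simp: R'_def L_def)
    moreover have "card (R' \<union> (L \<union> R \<inter> b i)) = card R' + card (L \<union> R \<inter> b i)"
      using fin b_mono[of i "Suc i"] by (intro card_Un_disjoint) (auto simp: R'_def L_def)
    moreover have "card (L \<union> R \<inter> b i) = card L + card (R \<inter> b i)"
      using fin by (intro card_Un_disjoint) (auto simp: L_def)
    ultimately show ?thesis by simp
  qed
  have far': "far \<M>' R' Y' \<subseteq> far \<M> R Y \<union> b i"
    using W S_b[of i] by (auto simp: far_def R'_def Y'_def L_def W_def)
  \<comment> \<open>Dissolving a bag may open shortcuts from the far side, but these pass through
    \<open>W\<close>, and the ball of radius \<open>r\<close> about \<open>W\<close> lies in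
    \<open>b (Suc i)\<close>, which misses \<open>R'\<close>.\<close>
  have "nbhd E U' r (far \<M> R Y \<union> b i) \<inter> R' = {}"
    using nbhd_Un_verts[of E U W r "far \<M> R Y"] nb_W sepR
    by (auto simp: nbhd_Un b_Suc[symmetric] U'[symmetric] R'_def)
  then have sep': "nbhd E U' r (far \<M>' R' Y') \<inter> R' = {}"
    using nbhd_mono[of U' U' r r "far \<M>' R' Y'" "far \<M> R Y \<union> b i" E] far' by auto
  have "card (R \<inter> b (Suc i)) \<le> card (R \<inter> b (N * m))"
    using fin b_mono[of "Suc i" "N * m"] i(1) by (intro card_mono) auto
  moreover have "card (R \<inter> b i) \<le> card (R \<inter> b (Suc i))"
    using fin b_mono[of i "Suc i"] by (intro card_mono) auto
  moreover have "2 * card (R \<inter> b (N * m)) \<le> card R" using half by (simp add: b_def U'_def)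
  \<comment> \<open>Balance holds because the remainder stays large: \<open>half\<close> and
    \<open>big\<close> leave more than a third of \<open>card V\<close> in
    \<open>R'\<close>.\<close>
  ultimately have "card R \<le> 2 * card R'" using card_R card_L by linarith
  moreover have "card (far \<M>' R' Y') + card R' \<le> card V"
  proof -
    have "card (far \<M>' R' Y' \<union> R') = card (far \<M>' R' Y') + card R'"
      using finite_V fin by (intro card_Un_disjoint) (auto simp: far_def R'_def)
    moreover have "card (far \<M>' R' Y' \<union> R') \<le> card V"
      using finite_V R by (intro card_mono) (auto simp: far_def R'_def U_def)
    ultimately show ?thesis by simp
  qed
  ultimately have bal: "3 * card (far \<M>' R' Y') \<le> 2 * card V" using big by linarith
  \<comment> \<open>No exceptional vertex becomes newly near: a short path through a dissolved bag
    would put its end in \<open>R'\<close> into \<open>b (Suc i)\<close>. For the same reason those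
    in \<open>S\<close> cease to be near.\<close>
  have near': "near \<M>' R' \<subseteq> near \<M> R - S"
  proof
    fix y assume y: "y \<in> near \<M>' R'"
    then obtain x where x: "x \<in> R'" "y \<in> nbhd E U' r {x}"
      using nbhd_eq_UN[of E U' r R'] by (auto simp: near_def U'_def)
    then have xy: "x \<in> nbhd E U' r {y}" using nbhd_sym[OF sym_E] by blast
    have "x \<in> nbhd E U r {y} \<union> nbhd E U' r W"
      using xy nbhd_Un_verts[of E U W r "{y}"] by (auto simp: U')
    then have "x \<in> nbhd E U r {y}" using nb_W x(1) by (auto simp: R'_def)
    then have "y \<in> nbhd E U r {x}" using nbhd_sym[OF sym_E] by blast
    moreover have "nbhd E U r {x} \<subseteq> nbhd E U r R"
      using x(1) by (intro nbhd_mono) (auto simp: R'_def)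
    moreover have "y \<notin> S"
      using xy nb_S nbhd_mono[of U' U' r r "{y}" S E] x(1) by (auto simp: R'_def)
    ultimately show "y \<in> near \<M> R - S" using y by (auto simp: near_def U_def)
  qed
  have fM: "finite \<M>" using finite_model[OF model] .
  have cM: "card \<M>' \<le> card \<M>" using sub fM by (intro card_mono) auto
  have cn: "card (near \<M>' R') \<le> card (near \<M> R)"
    using near' finite_near by (intro card_mono) auto
  have dec: "card (near \<M>' R') + card \<M>' < card (near \<M> R) + card \<M> \<and> rank \<M>' R' < rank \<M> R"
  proof (cases "card \<M>' < card \<M>")
    case True
    then show ?thesis using cn by (auto simp: rank_def)
  next
    case False
    then have "near \<M>' R' \<subset> near \<M> R" using progress near' by auto
    then have "card (near \<M>' R') < card (near \<M> R)" by (intro psubset_card_mono finite_near)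
    then show ?thesis using cM by (auto simp: rank_def)
  qed
  \<comment> \<open>The layer is paid by \<open>i(2)\<close>: the term for the ball is released as
    the ball leaves \<open>R\<close>, and the extra \<open>card V\<close> is the charge of the
    centre, released by \<open>dec\<close>.\<close>
  have "N * Q * card Y' + Q * card R' + card V * (card (near \<M>' R') + card \<M>')
      \<le> N * Q * card Y + N * Q * card L + Q * card R' + card V * (card (near \<M>' R') + card \<M>')"
    using card_Un_le[of Y L] by (simp add: Y'_def flip: distrib_left)
  also have "\<dots> \<le> N * Q * card Y + (card V + Q * card (R \<inter> b i)) + Q * card R'
      + card V * (card (near \<M>' R') + card \<M>')"
    using i(2) by (simp add: card_L)
  also have "\<dots> \<le> N * Q * card Y + Q * card R
      + card V * (card (near \<M>' R') + card \<M>' + 1)"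
    by (simp add: card_R algebra_simps)
  also have "\<dots> \<le> N * Q * card Y + Q * card R + card V * (card (near \<M> R) + card \<M>)"
    using dec by (intro add_left_mono mult_le_mono2) linarith
  finally have pot': "N * Q * card Y' + Q * card R' + card V * (card (near \<M>' R') + card \<M>')
      \<le> 2 * card V * Q" using pot by linarith
  have "clique_model E V D \<M>'" using clique_model_subset[OF model sub] .
  moreover have "\<forall>M\<in>\<M>'. card M \<le> h * Suc D + 1" using st sub by (auto simp: state_def)
  moreover have "R' \<subseteq> V - \<Union>\<M>'" using R sub by (auto simp: R'_def U_def)
  moreover have "Y' \<subseteq> V" using Y R by (auto simp: Y'_def L_def U_def)
  ultimately have "state \<M>' R' Y'"
    using sep' bal pot' unfolding state_def U'_def by simp
  then show ?thesis using dec by blast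
qed

text \<open>Walks from \<open>z\<close> to a neighbour of each bag, taken outside the bags, unite to
  a new bag adjacent to all others. The charge of \<open>z\<close> passes to the new bag, so the
  potential does not grow.\<close>

lemma add_bag:
  assumes st: "state \<M> R Y" and z: "z \<in> near \<M> R"
    and reach: "\<And>M. M \<in> \<M> \<Longrightarrow> nbhd E (V - \<Union>\<M>) D {z} \<inter> E `` M \<noteq> {}"
  shows "\<exists>\<M>' R' Y'. state \<M>' R' Y' \<and> rank \<M>' R' < rank \<M> R"
proof -
  define U where "U = V - \<Union>\<M>"
  have model: "clique_model E V D \<M>" and R: "R \<subseteq> U" and Y: "Y \<subseteq> V"
    and sepR: "nbhd E U r (far \<M> R Y) \<inter> R = {}"
    and bal: "3 * card (far \<M> R Y) \<le> 2 * card V"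
    and pot: "N * Q * card Y + Q * card R + card V * (card (near \<M> R) + card \<M>) \<le> 2 * card V * Q"
    using st by (auto simp: state_def U_def)
  have fM: "finite \<M>" using finite_model[OF model] .
  have zU: "z \<in> U" using z nbhd_subset[of E U r R] by (auto simp: near_def U_def)
  have "\<exists>P. finite P \<and> P \<subseteq> U \<and> z \<in> P \<and> P \<inter> E `` M \<noteq> {} \<and> card P \<le> Suc D \<and> P \<subseteq> nbhd E P D {z}"
    if M: "M \<in> \<M>" for M
  proof -
    obtain y where y: "y \<in> nbhd E U D {z}" "y \<in> E `` M"
      using reach[OF M] unfolding U_def by blast
    obtain P where "finite P" "P \<subseteq> U" "z \<in> P" "y \<in> P" "card P \<le> Suc D" "P \<subseteq> nbhd E P D {z}"
      using nbhd_path[OF y(1)] by blast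
    then show ?thesis using y(2) by (intro exI[of _ P]) blast
  qed
  then obtain p where p: "\<And>M. M \<in> \<M> \<Longrightarrow> p M \<subseteq> U \<and> z \<in> p M \<and> p M \<inter> E `` M \<noteq> {} \<and>
      card (p M) \<le> Suc D \<and> p M \<subseteq> nbhd E (p M) D {z}"
    by metis
  \<comment> \<open>Inserting \<open>z\<close> explicitly covers the case without bags, in which the
    new bag is \<open>{z}\<close>.\<close>
  define P where "P = insert z (\<Union>(p ` \<M>))"
  have PU: "P \<subseteq> U" using p zU by (auto simp: P_def)
  have "card P \<le> Suc (card (\<Union>(p ` \<M>)))"
    unfolding P_def by (rule card_insert_le_m1) auto
  also have "card (\<Union>(p ` \<M>)) \<le> (\<Sum>M\<in>\<M>. card (p M))"
    using fM by (rule card_UN_le)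
  also have "\<dots> \<le> card \<M> * Suc D"
    using sum_bounded_above[of \<M> "\<lambda>M. card (p M)" "Suc D"] p by simp
  also have "\<dots> \<le> h * Suc D"
    using models[of \<M>] model by (intro mult_le_mono) (auto simp: D_def)
  finally have card_P: "card P \<le> h * Suc D + 1" by simp
  have rad: "P \<subseteq> nbhd E P D {z}"
  proof
    fix y assume "y \<in> P"
    then consider "y = z" | M where "M \<in> \<M>" "y \<in> p M" by (auto simp: P_def)
    then show "y \<in> nbhd E P D {z}"
    proof cases
      case 1
      then show ?thesis using nbhd_base[of "{z}" P E D] by (auto simp: P_def)
    next
      case 2
      then have "p M \<subseteq> P" by (auto simp: P_def)
      then have "nbhd E (p M) D {z} \<subseteq> nbhd E P D {z}" by (intro nbhd_mono) auto
      then show ?thesis using p[OF 2(1)] 2(2) by blast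
    qed
  qed
  have adj: "E `` M \<inter> P \<noteq> {}" if "M \<in> \<M>" for M using p[OF that] that by (auto simp: P_def)
  then have adj': "E `` P \<inter> M \<noteq> {}" if "M \<in> \<M>" for M
    using that sym_E by (fastforce dest: symD)
  have disj: "P \<inter> M = {}" if "M \<in> \<M>" for M using PU that by (auto simp: U_def)
  have zP: "z \<in> P" by (simp add: P_def)
  define \<M>' where "\<M>' = insert P \<M>"
  have model': "clique_model E V D \<M>'"
    using model PU rad zP adj adj' disj unfolding clique_model_def \<M>'_def U_def
    by (auto simp: Int_commute)
  have "P \<notin> \<M>" using zP disj by blast
  then have cM: "card \<M>' = Suc (card \<M>)" using fM by (simp add: \<M>'_def)
  define R' where "R' = R - P"
  have U': "V - \<Union>\<M>' = U - P" by (auto simp: \<M>'_def U_def)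
  have far': "far \<M>' R' Y \<subseteq> far \<M> R Y" by (auto simp: far_def \<M>'_def R'_def)
  have "nbhd E (U - P) r (far \<M>' R' Y) \<subseteq> nbhd E U r (far \<M> R Y)"
    using far' by (intro nbhd_mono) auto
  then have sep': "nbhd E (U - P) r (far \<M>' R' Y) \<inter> R' = {}" using sepR by (auto simp: R'_def)
  have "card (far \<M>' R' Y) \<le> card (far \<M> R Y)"
    using far' finite_V by (intro card_mono) (auto simp: far_def)
  then have bal': "3 * card (far \<M>' R' Y) \<le> 2 * card V" using bal by linarith
  have "nbhd E (U - P) r R' \<subseteq> nbhd E U r R \<inter> (U - P)"
    using nbhd_subset[of E "U - P" r R'] nbhd_mono[of "U - P" U r r R' R E] by (auto simp: R'_def)
  then have "near \<M>' R' \<subset> near \<M> R"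
    using z zP unfolding near_def U' by (auto simp: U_def)
  then have cn: "card (near \<M>' R') < card (near \<M> R)" by (intro psubset_card_mono finite_near)
  have "card R' \<le> card R"
    using R finite_V by (intro card_mono) (auto simp: R'_def U_def intro: finite_subset)
  moreover have "card (near \<M>' R') + card \<M>' \<le> card (near \<M> R) + card \<M>"
    using cn cM by simp
  ultimately have "N * Q * card Y + Q * card R' + card V * (card (near \<M>' R') + card \<M>')
      \<le> N * Q * card Y + Q * card R + card V * (card (near \<M> R) + card \<M>)"
    by (meson add_le_mono mult_le_mono2 order.refl)
  then have "state \<M>' R' Y"
    using model' st card_P R Y sep' bal' pot unfolding state_def U'
    by (auto simp: \<M>'_def R'_def U_def)
  moreover have "rank \<M>' R' < rank \<M> R" using cn cM by (simp add: rank_def)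
  ultimately show ?thesis by blast
qed

text \<open>If \<open>z\<close> does not reach a bag \<open>M\<close>, the balls of radius
  \<open>D / 2\<close> about \<open>z\<close> and about \<open>M\<close> have disjoint traces on
  \<open>R\<close>: a common vertex would, by the last exit from \<open>M\<close>, give a neighbour
  of \<open>M\<close> within \<open>D\<close> of \<open>z\<close>. So one of them holds at most half
  of \<open>R\<close> and can be cut off.\<close>

lemma advance:
  assumes st: "state \<M> R Y" and z: "z \<in> near \<M> R" and big: "2 * card V < 3 * card R"
  shows "\<exists>\<M>' R' Y'. state \<M>' R' Y' \<and> rank \<M>' R' < rank \<M> R"
proof (cases "\<forall>M\<in>\<M>. nbhd E (V - \<Union>\<M>) D {z} \<inter> E `` M \<noteq> {}")
  case True
  then show ?thesis using add_bag[OF st z] by blast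
next
  case False
  define U where "U = V - \<Union>\<M>"
  define k where "k = r * (N * m)"
  from False obtain M where M: "M \<in> \<M>" "nbhd E U D {z} \<inter> E `` M = {}" by (auto simp: U_def)
  have model: "clique_model E V D \<M>" and R: "R \<subseteq> U"
    using st by (auto simp: state_def U_def)
  have zU: "z \<in> U" using z nbhd_subset[of E U r R] by (auto simp: near_def U_def)
  have UM: "V - \<Union>(\<M> - {M}) = U \<union> M"
    using model M(1) by (auto simp: clique_model_def U_def)
  have MU: "\<Union>\<M> - \<Union>(\<M> - {M}) \<subseteq> M" by auto
  have disj: "nbhd E U k {z} \<inter> nbhd E (U \<union> M) k M \<inter> R = {}"
  proof (rule ccontr)
    assume "\<not> ?thesis"
    then obtain v where v: "v \<in> nbhd E U k {z}" "v \<in> nbhd E (U \<union> M) k M" "v \<in> R" by auto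
    have "v \<notin> M" using v(3) R M(1) by (auto simp: U_def)
    then have "v \<in> nbhd E U k (E `` M)" using v(2) nbhd_leave[of E U M k] by auto
    then obtain y where y: "y \<in> E `` M" "v \<in> nbhd E U k {y}"
      using nbhd_eq_UN[of E U k "E `` M"] by auto
    have "nbhd E U k {v} \<subseteq> nbhd E U (k + k) {z}"
      unfolding nbhd_add using v(1) by (intro nbhd_mono) auto
    then have "y \<in> nbhd E U D {z}"
      using nbhd_sym[OF sym_E y(2)] by (auto simp: D_def k_def mult_2)
    then show False using M(2) y(1) by auto
  qed
  have fR: "finite R" using R finite_V by (auto simp: U_def intro: finite_subset)
  have "card (R \<inter> nbhd E U k {z}) + card (R \<inter> nbhd E (U \<union> M) k M)
      = card (R \<inter> nbhd E U k {z} \<union> R \<inter> nbhd E (U \<union> M) k M)"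
    using fR disj by (intro card_Un_disjoint[symmetric]) auto
  also have "\<dots> \<le> card R" using fR by (intro card_mono) auto
  finally consider "2 * card (R \<inter> nbhd E U k {z}) \<le> card R"
    | "2 * card (R \<inter> nbhd E (U \<union> M) k M) \<le> card R" by linarith
  then show ?thesis
  proof cases
    case 1
    then have "\<exists>R' Y'. state \<M> R' Y' \<and> rank \<M> R' < rank \<M> R"
      using zU z big by (intro cut[OF st, where S = "{z}"]) (auto simp: U_def k_def)
    then show ?thesis by blast
  next
    case 2
    have "card (\<M> - {M}) < card \<M>"
      using M(1) finite_model[OF model] by (intro psubset_card_mono) auto
    then have "\<exists>R' Y'. state (\<M> - {M}) R' Y' \<and> rank (\<M> - {M}) R' < rank \<M> R"
      using 2 big MU UM by (intro cut[OF st, where S = M]) (auto simp: k_def)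
    then show ?thesis by blast
  qed
qed

text \<open>The potential starts with \<open>Q * card V\<close> for \<open>R\<close> and at most
  \<open>card V * Q\<close> for the charges, whence the bound \<open>2 * card V * Q\<close> in
  \<open>state\<close>.\<close>

lemma state_initial: "state {} V {}"
proof -
  have "card (near {} V) \<le> Q"
    using card_Z card_mono[of Z "near {} V"] Z_subset finite_V
    by (auto simp: near_def intro: finite_subset order.trans)
  then have "card V * card (near {} V) \<le> card V * Q" by simp
  moreover have "nbhd E V r {} = {}" using nbhd_eq_UN[of E V r "{}"] by simp
  ultimately show ?thesis
    by (auto simp: state_def clique_model_def far_def)
qed

text \<open>In a state of least rank \<open>advance\<close> cannot apply, so either \<open>R\<close>
  is small enough to be a side or no exceptional vertex is near \<open>R\<close>. In the second case
  the old separation still works within \<open>R\<close>.\<close>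

lemma refine:
  "\<exists>Z' X' A' B'. dist_separation E V r Z' X' A' B' \<and>
    card Z' \<le> h * (h * Suc D + 1) \<and> N * card X' \<le> N * card X + 2 * card V"
proof -
  define P where "P = (\<lambda>(\<M>, R, Y). state \<M> R Y)"
  define \<mu> where "\<mu> = (\<lambda>(\<M>, R, Y :: 'a set). rank \<M> R)"
  have "P ({}, V, {})" using state_initial by (simp add: P_def)
  from ex_has_least_nat[of P, OF this, of \<mu>] obtain s where "P s" and least: "\<forall>t. P t \<longrightarrow> \<mu> s \<le> \<mu> t"
    by blast
  moreover obtain \<M> R Y where s: "s = (\<M>, R, Y)" by (cases s)
  ultimately have st: "state \<M> R Y" by (simp add: P_def)
  have min: "rank \<M> R \<le> rank \<M>' R'" if "state \<M>' R' Y'" for \<M>' R' Y'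
    using least[rule_format, of "(\<M>', R', Y')"] that by (simp add: P_def \<mu>_def s)
  have stop: "3 * card R \<le> 2 * card V \<or> near \<M> R = {}"
  proof (rule ccontr)
    assume "\<not> ?thesis"
    then obtain z where z: "z \<in> near \<M> R" and big: "2 * card V < 3 * card R" by auto
    obtain \<M>' R' Y' where "state \<M>' R' Y'" "rank \<M>' R' < rank \<M> R"
      using advance[OF st z big] by blast
    then show False using min[of \<M>' R' Y'] by simp
  qed
  define U where "U = V - \<Union>\<M>"
  have model: "clique_model E V D \<M>" and R: "R \<subseteq> U" and Y: "Y \<subseteq> V"
    and sepR: "nbhd E U r (far \<M> R Y) \<inter> R = {}"
    and bal: "3 * card (far \<M> R Y) \<le> 2 * card V"
    and pot: "N * Q * card Y + Q * card R + card V * (card (near \<M> R) + card \<M>) \<le> 2 * card V * Q"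
    and bags: "\<forall>M\<in>\<M>. card M \<le> h * Suc D + 1"
    using st by (auto simp: state_def U_def)
  have MV: "\<Union>\<M> \<subseteq> V" using model by (auto simp: clique_model_def)
  have "card (\<Union>\<M>) \<le> (\<Sum>M\<in>\<M>. card M)"
    using card_UN_le[OF finite_model[OF model], of id] by simp
  also have "\<dots> \<le> card \<M> * (h * Suc D + 1)"
    using sum_bounded_above[of \<M> card "h * Suc D + 1"] bags by simp
  also have "\<dots> \<le> h * (h * Suc D + 1)"
    using models[of \<M>] model by (intro mult_le_mono) (auto simp: D_def)
  finally have card_M: "card (\<Union>\<M>) \<le> h * (h * Suc D + 1)" .
  have "N * Q * card Y \<le> 2 * card V * Q" using pot by linarith
  then have "Q * (N * card Y) \<le> Q * (2 * card V)" by (simp only: ac_simps)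
  then have card_Y: "N * card Y \<le> 2 * card V"
    using Q_pos by (simp only: mult_le_cancel1)
  have UZ: "V - \<Union>\<M> - Y = far \<M> R Y \<union> (R - Y)" using R by (auto simp: far_def U_def)
  have "R \<subseteq> V" using R by (auto simp: U_def)
  then have fin: "finite (far \<M> R Y)" "finite R" "finite Y"
    using finite_V Y by (simp_all add: far_def finite_subset)
  show ?thesis
  proof (cases "3 * card R \<le> 2 * card V")
    case True
    have "card (R - Y) \<le> card R" using fin by (intro card_mono) auto
    then have "3 * card (R - Y) \<le> 2 * card V" using True by linarith
    moreover have "far \<M> R Y \<inter> (R - Y) = {}" by (auto simp: far_def)
    moreover have "nbhd E U r (far \<M> R Y) \<inter> (R - Y) = {}" using sepR by blast
    ultimately have "dist_separation E V r (\<Union>\<M>) Y (far \<M> R Y) (R - Y)"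
      using bal MV Y UZ unfolding dist_separation_def U_def by simp
    moreover have "N * card Y \<le> N * card X + 2 * card V" using card_Y by simp
    ultimately show ?thesis using card_M by blast
  next
    case False
    with stop have nothing_near: "near \<M> R = {}" by blast
    have "card (far \<M> R Y \<union> R) \<le> card V"
      using finite_V R by (intro card_mono) (auto simp: far_def U_def)
    moreover have "card (far \<M> R Y \<union> R) = card (far \<M> R Y) + card R"
      using fin by (intro card_Un_disjoint) (auto simp: far_def)
    ultimately have far_R: "card (far \<M> R Y) + card R \<le> card V" by simp
    \<comment> \<open>The far side joins the smaller trace on \<open>R\<close>, which is at most
      half of \<open>R\<close>; as \<open>R\<close> exceeds two thirds of \<open>V\<close>, the sum
      stays below two thirds. Symmetry covers the other labelling.\<close>
    have goal: ?thesis if AB: "dist_separation E V r Z X A' B'" "card (R \<inter> A') \<le> card (R \<inter> B')"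
      for A' B'
    proof -
      define A'' where "A'' = (R \<inter> A' - Y) \<union> (far \<M> R Y - X)"
      define B'' where "B'' = R \<inter> B' - Y"
      have AB': "A' \<union> B' = V - Z - X" "A' \<inter> B' = {}" "3 * card B' \<le> 2 * card V"
        "nbhd E (V - Z) r A' \<inter> B' = {}"
        using AB by (auto simp: dist_separation_def)
      have "Z \<inter> R = {}"
        using nothing_near nbhd_base[of R U E r] R by (auto simp: near_def U_def)
      then have part: "A'' \<union> B'' = V - \<Union>\<M> - (Y \<union> X)"
        using AB'(1) R by (auto simp: A''_def B''_def far_def U_def)
      \<comment> \<open>A short path between the two traces either avoids \<open>Z\<close>, which
        the old separation excludes, or contains an exceptional vertex near
        \<open>R\<close>.\<close>
      have "nbhd E U r (R \<inter> A') \<inter> (R \<inter> B') = {}"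
      proof (rule ccontr)
        assume "\<not> ?thesis"
        then obtain x where x: "x \<in> nbhd E U r (R \<inter> A')" "x \<in> R" "x \<in> B'" by auto
        have "U - Z \<union> U \<inter> Z = U" by auto
        then have "x \<in> nbhd E (U - Z) r (R \<inter> A') \<or> x \<in> nbhd E U r (U \<inter> Z)"
          using nbhd_Un_verts[of E "U - Z" "U \<inter> Z" r "R \<inter> A'"] x(1) by auto
        moreover have "nbhd E (U - Z) r (R \<inter> A') \<subseteq> nbhd E (V - Z) r A'"
          by (intro nbhd_mono) (auto simp: U_def)
        ultimately obtain z where z: "z \<in> Z" "x \<in> nbhd E U r {z}"
          using AB'(4) x(3) nbhd_eq_UN[of E U r "U \<inter> Z"] by auto
        then have "z \<in> nbhd E U r R"
          using nbhd_sym[OF sym_E z(2)] x(2) nbhd_eq_UN[of E U r R] by blast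
        then show False using z nothing_near by (auto simp: near_def U_def)
      qed
      then have "nbhd E U r A'' \<inter> B'' = {}"
        using sepR nbhd_mono[of U U r r "R \<inter> A' - Y" "R \<inter> A'" E]
          nbhd_mono[of U U r r "far \<M> R Y - X" "far \<M> R Y" E]
        by (auto simp: A''_def B''_def nbhd_Un)
      moreover have "3 * card B'' \<le> 2 * card V"
      proof -
        have "finite B'" using AB'(1) finite_V by (metis finite_Diff finite_Un)
        then have "card B'' \<le> card B'" by (intro card_mono) (auto simp: B''_def)
        then show ?thesis using AB'(3) by linarith
      qed
      moreover have "3 * card A'' \<le> 2 * card V"
      proof -
        have "card (R \<inter> A' \<union> R \<inter> B') = card (R \<inter> A') + card (R \<inter> B')"
          using fin AB'(2) by (intro card_Un_disjoint) auto
        moreover have "card (R \<inter> A' \<union> R \<inter> B') \<le> card R" using fin by (intro card_mono) auto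
        moreover have "card A'' \<le> card (R \<inter> A' \<union> far \<M> R Y)"
          using fin by (intro card_mono) (auto simp: A''_def)
        moreover have "card (R \<inter> A' \<union> far \<M> R Y) \<le> card (R \<inter> A') + card (far \<M> R Y)"
          by (rule card_Un_le)
        ultimately show ?thesis using AB(2) far_R False by linarith
      qed
      moreover have "A'' \<inter> B'' = {}" using AB'(2) by (auto simp: A''_def B''_def far_def)
      ultimately have "dist_separation E V r (\<Union>\<M>) (Y \<union> X) A'' B''"
        using part MV Y AB(1) by (auto simp: dist_separation_def U_def)
      moreover have "N * card (Y \<union> X) \<le> N * card X + 2 * card V"
      proof -
        have "N * card (Y \<union> X) \<le> N * (card Y + card X)" by (intro mult_le_mono2 card_Un_le)
        then show ?thesis using card_Y by (simp add: distrib_left)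
      qed
      ultimately show ?thesis using card_M by blast
    qed
    show ?thesis
      using goal[OF sep] goal[OF dist_separation_commute[OF sym_E sep]]
        linear[of "card (R \<inter> A)" "card (R \<inter> B)"] by blast
  qed
qed

end

section \<open>Iterating the refinement\<close>

text \<open>Replace the coefficients by absolute values; the base \<open>Suc x\<close> makes every
  lower power at most the top one, also at \<open>x = 0\<close>.\<close>

lemma polynomial_fun_bound:
  assumes "polynomial_fun p"
  obtains c e :: nat where "\<And>x. p x \<le> c * Suc x ^ e"
proof -
  obtain P :: "real poly" where P: "\<And>x. real (p x) = poly P (real x)"
    using assms by (auto simp: polynomial_fun_def)
  define c where "c = nat \<lceil>\<Sum>i\<le>degree P. \<bar>coeff P i\<bar>\<rceil>"
  have "p x \<le> c * Suc x ^ degree P" for x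
  proof -
    have "real (p x) = (\<Sum>i\<le>degree P. coeff P i * real x ^ i)"
      by (simp add: P poly_altdef)
    also have "\<dots> \<le> (\<Sum>i\<le>degree P. \<bar>coeff P i\<bar> * real (Suc x) ^ degree P)"
    proof (intro sum_mono mult_mono)
      fix i assume "i \<in> {..degree P}"
      have "real x ^ i \<le> real (Suc x) ^ i" by (intro power_mono) auto
      also have "\<dots> \<le> real (Suc x) ^ degree P"
        using \<open>i \<in> _\<close> by (intro power_increasing) auto
      finally show "real x ^ i \<le> real (Suc x) ^ degree P" .
    qed auto
    also have "\<dots> \<le> real c * real (Suc x) ^ degree P"
      unfolding c_def sum_distrib_right[symmetric] by (intro mult_right_mono) (linarith, simp)
    finally have "real (p x) \<le> real (c * Suc x ^ degree P)" by simp
    then show ?thesis by (simp only: of_nat_le_iff)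
  qed
  then show thesis using that by blast
qed

section \<open>Logarithmic bounds and repeated rounds\<close>

lemma iter_log_ge_1: "1 \<le> x \<Longrightarrow> 1 \<le> iter_log i x"
  by (cases i) (auto simp: le_log_iff)

lemma log_le_self:
  assumes "k > 0"
  shows "log 2 (real k) \<le> real k"
proof -
  have "real k \<le> 2 ^ k" by (simp add: less_imp_le)
  then show ?thesis using assms by (simp add: log_le_iff powr_realpow)
qed

text \<open>Supplies the number of doublings for the growth argument: with \<open>f\<close> the
  integer part of the logarithm, \<open>Q < 2 ^ (f + 1)\<close>, so \<open>m = f + 2\<close>
  works.\<close>

lemma exists_binary_length:
  assumes "Q > 0"
  shows "\<exists>m. 2 * Q < 2 ^ m \<and> real m \<le> log 2 (real Q) + 2"
proof -
  define f where "f = nat \<lfloor>log 2 (real Q)\<rfloor>"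
  have "0 \<le> log 2 (real Q)" using assms by simp
  then have f: "real f \<le> log 2 (real Q)" "log 2 (real Q) < real (Suc f)"
    unfolding f_def by linarith+
  then have "real Q < 2 powr real (Suc f)" using assms by (simp add: log_less_iff)
  then have "real Q < real (2 ^ Suc f)" by (simp add: powr_realpow del: of_nat_Suc)
  then have "Q < 2 ^ Suc f" by (simp only: of_nat_less_iff)
  then show ?thesis using f by (intro exI[of _ "Suc (Suc f)"]) auto
qed

text \<open>The new bound depends on the old \<open>card Z\<close> only through \<open>m\<close>,
  about \<open>log 2 Q\<close>, so a round turns a power of \<open>N * iter_log j\<close> into a
  power of \<open>N * iter_log (Suc j)\<close>, while \<open>X\<close> grows by at most
  \<open>2 * card V / N\<close>. \<open>K\<close> and \<open>d\<close> are fixed before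
  \<open>E\<close>, \<open>V\<close> and \<open>N\<close>.\<close>

lemma iterated_separation:
  fixes p :: "nat \<Rightarrow> nat" and c e r j :: nat
  assumes p: "\<And>x. p x \<le> c * Suc x ^ e"
  shows "\<exists>(K :: nat) d :: nat. K > 0 \<and> (\<forall>(E :: 'a rel) V N.
    finite V \<and> V \<noteq> {} \<and> sym E \<and> N > 0 \<and>
    (\<forall>D \<M>. clique_model E V D \<M> \<longrightarrow> card \<M> \<le> 2 * p D + 1) \<longrightarrow>
    (\<exists>Z X A B. dist_separation E V r Z X A B \<and> N * card X \<le> 2 * j * card V \<and>
      real (card Z) \<le> real K * (real N * iter_log j (card V)) ^ d))"
proof (induction j)
  case 0
  have "\<exists>Z X A B. dist_separation E V r Z X A B \<and> N * card X \<le> 2 * 0 * card V \<and>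
      real (card Z) \<le> 1 * (real N * iter_log 0 (card V)) ^ 1"
    if "finite V" "N > 0" for E :: "'a rel" and V and N :: nat
  proof (intro exI conjI)
    show "dist_separation E V r V {} {} {}" by (auto simp: dist_separation_def)
    have "real (card V) * 1 \<le> real (card V) * real N" using \<open>N > 0\<close> by (intro mult_left_mono) auto
    then show "real (card V) \<le> 1 * (real N * iter_log 0 (card V)) ^ 1" by (simp add: mult.commute)
  qed simp
  then show ?case by (intro exI[of _ 1]) auto
next
  case (Suc j)
  then obtain K d :: nat where K: "K > 0" and IH: "\<forall>(E :: 'a rel) V N.
      finite V \<and> V \<noteq> {} \<and> sym E \<and> N > 0 \<and>
      (\<forall>D \<M>. clique_model E V D \<M> \<longrightarrow> card \<M> \<le> 2 * p D + 1) \<longrightarrow>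
      (\<exists>Z X A B. dist_separation E V r Z X A B \<and> N * card X \<le> 2 * j * card V \<and>
        real (card Z) \<le> real K * (real N * iter_log j (card V)) ^ d)"
    by (elim exE conjE) (rule that)
  \<comment> \<open>\<open>K1\<close> will bound \<open>m / y\<close>, \<open>K2\<close> will bound
    \<open>Suc D / y ^ 2\<close>, and \<open>K'\<close>, \<open>d'\<close> come from inserting these
    in \<open>2 * h ^ 2 * Suc D\<close>.\<close>
  define K1 where "K1 = K + 2 * d + 2"
  define K2 where "K2 = 2 * r * K1 + 1"
  define K' where "K' = 2 * (2 * c + 1) ^ 2 * K2 ^ (2 * e + 1)"
  define d' where "d' = 2 * (2 * e + 1)"
  have "\<exists>Z X A B. dist_separation E V r Z X A B \<and> N * card X \<le> 2 * Suc j * card V \<and>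
      real (card Z) \<le> K' * (real N * iter_log (Suc j) (card V)) ^ d'"
    if hyps: "finite V \<and> V \<noteq> {} \<and> sym E \<and> N > 0 \<and>
      (\<forall>D \<M>. clique_model E V D \<M> \<longrightarrow> card \<M> \<le> 2 * p D + 1)"
    for E :: "'a rel" and V and N :: nat
  proof -
    have V: "finite V" "V \<noteq> {}" and sym: "sym E" and N: "N > 0"
      and models: "\<And>D \<M>. clique_model E V D \<M> \<Longrightarrow> card \<M> \<le> 2 * p D + 1"
      using hyps by simp_all
    define L0 where "L0 = iter_log j (card V)"
    define L where "L = iter_log (Suc j) (card V)"
    \<comment> \<open>One quantity dominating both \<open>N\<close> and \<open>L\<close>, so that
      all bounds become powers of it.\<close>
    define y where "y = real N * L"
    obtain Z X A B where sep: "dist_separation E V r Z X A B"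
      and X: "N * card X \<le> 2 * j * card V"
      and Z: "real (card Z) \<le> K * (real N * L0) ^ d"
      using IH[rule_format, OF hyps] unfolding L0_def[symmetric] by (elim exE conjE) (rule that)
    have "card V > 0" using V by (simp add: card_gt_0_iff)
    then have L: "L0 \<ge> 1" "L \<ge> 1" unfolding L0_def L_def by (auto intro!: iter_log_ge_1)
    have y: "real N \<le> y" "L \<le> y" "1 \<le> y"
    proof -
      show N_y: "real N \<le> y" using mult_left_mono[of 1 L "real N"] L by (simp add: y_def)
      show "L \<le> y" using mult_right_mono[of 1 "real N" L] L N by (simp add: y_def)
      show "1 \<le> y" using N N_y by linarith
    qed
    define Q where "Q = max 1 (card Z)"
    have "1 \<le> real K * (real N * L0) ^ d"
      using K N L by (intro mult_ge1_I one_le_power) auto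
    then have Q: "real Q \<le> K * (real N * L0) ^ d" using Z by (simp add: Q_def)
    obtain m where m: "2 * Q < 2 ^ m" "real m \<le> log 2 (real Q) + 2"
      using exists_binary_length[of Q] by (metis Q_def max.strict_coboundedI1 zero_less_one)
    have "log 2 (real Q) \<le> log 2 (K * (real N * L0) ^ d)"
      using Q by (intro log_mono) (auto simp: Q_def)
    also have "\<dots> = log 2 (real K) + d * (log 2 (real N) + log 2 L0)"
      using K N L by (simp add: log_mult log_nat_power)
    also have "\<dots> \<le> real K * y + d * (y + y)"
    proof (intro add_mono mult_left_mono)
      have "real K * 1 \<le> real K * y" using y by (intro mult_left_mono) auto
      then show "log 2 (real K) \<le> real K * y" using log_le_self[OF K] by linarith
      show "log 2 (real N) \<le> y" using log_le_self[OF N] y by linarith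
      have "log 2 L0 \<le> L" using L by (auto simp: L_def L0_def)
      then show "log 2 L0 \<le> y" using y by linarith
    qed simp
    finally have "real m \<le> real K * y + d * (y + y) + 2 * y" using m y by linarith
    then have my: "real m \<le> K1 * y" by (simp add: K1_def algebra_simps)
    define D where "D = 2 * (r * (N * m))"
    define h where "h = 2 * p D + 1"
    interpret ref: separation_refinement E V Z X A B r h N m Q
      using V sym sep m(1) N models by unfold_locales (auto simp: Q_def h_def D_def)
    have D_eq: "ref.D = D" by (simp add: ref.D_def D_def)
    obtain Z' X' A' B' where res: "dist_separation E V r Z' X' A' B'"
      "card Z' \<le> h * (h * Suc D + 1)" "N * card X' \<le> N * card X + 2 * card V"
      using ref.refine unfolding D_eq by blast
    have y2: "1 \<le> y ^ 2" using y by (intro one_le_power)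
    have "real N * real m \<le> y * (K1 * y)" using y my by (intro mult_mono) auto
    then have "real r * (real N * real m) \<le> real r * (y * (K1 * y))" by (intro mult_left_mono) auto
    then have "real (Suc D) \<le> 2 * (real r * (y * (K1 * y))) + y ^ 2"
      using y2 by (simp add: D_def)
    also have "\<dots> = K2 * y ^ 2" by (simp add: K2_def power2_eq_square algebra_simps)
    finally have Dy: "real (Suc D) \<le> K2 * y ^ 2" .
    have "1 \<le> real (Suc D)" by simp
    then have "1 \<le> (K2 * y ^ 2) ^ e" using Dy by (intro one_le_power) linarith
    have "real h \<le> real (2 * (c * Suc D ^ e) + 1)"
      unfolding h_def using p[of D] by (simp only: of_nat_le_iff)
    also have "\<dots> = 2 * c * real (Suc D) ^ e + 1" by simp
    also have "\<dots> \<le> 2 * c * (K2 * y ^ 2) ^ e + (K2 * y ^ 2) ^ e"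
      using Dy \<open>1 \<le> (K2 * y ^ 2) ^ e\<close> by (intro add_mono mult_left_mono power_mono) auto
    finally have hy: "real h \<le> (2 * c + 1) * (K2 * y ^ 2) ^ e" by (simp add: algebra_simps)
    \<comment> \<open>\<open>h\<close> and \<open>Suc D\<close> are at least 1, so doubling absorbs
      the summand 1.\<close>
    have "h * (h * Suc D + 1) \<le> h * (2 * (h * Suc D))"
      unfolding h_def by (intro mult_le_mono2) simp
    then have "card Z' \<le> 2 * (h * h * Suc D)" using res(2) by (simp add: algebra_simps)
    then have "real (card Z') \<le> real (2 * (h * h * Suc D))" by (simp only: of_nat_le_iff)
    also have "\<dots> = 2 * (real h ^ 2 * real (Suc D))" by (simp add: power2_eq_square algebra_simps)
    also have "\<dots> \<le> 2 * (((2 * c + 1) * (K2 * y ^ 2) ^ e) ^ 2 * (K2 * y ^ 2))"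
      using hy Dy by (intro mult_left_mono mult_mono power_mono) auto
    also have "\<dots> = 2 * real (2 * c + 1) ^ 2 * (((K2 * y ^ 2) ^ e) ^ 2 * (K2 * y ^ 2))"
      by (simp add: power_mult_distrib)
    also have "((K2 * y ^ 2) ^ e) ^ 2 * (K2 * y ^ 2) = (K2 * y ^ 2) ^ (2 * e + 1)"
      by (simp add: power_mult[symmetric] mult.commute)
    also have "\<dots> = real K2 ^ (2 * e + 1) * y ^ d'"
      unfolding d'_def by (simp only: power_mult_distrib power_mult)
    finally have "real (card Z') \<le> K' * y ^ d'" by (simp add: K'_def)
    moreover have "N * card X' \<le> 2 * Suc j * card V" using X res(3) by simp
    ultimately show ?thesis using res(1) unfolding y_def L_def by blast
  qed
  moreover have "K' > 0" by (simp add: K'_def K2_def)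
  ultimately show ?case
    by (intro exI[where x = K'] exI[where x = d'] conjI allI impI)
qed

section \<open>Absorbing powers of iterated logarithms\<close>

text \<open>From \<open>x \<le> exp x\<close> at \<open>x = ln u / d\<close>, raised to the power
  \<open>d\<close>; the factor \<open>2 ^ d\<close> pays for
  \<open>log 2 u \<le> 2 * ln u\<close>.\<close>

lemma log_power_le:
  assumes "u \<ge> 1"
  shows "log 2 u ^ d \<le> (2 * d) ^ d * u"
proof (cases "d = 0")
  case False
  have "ln u / d \<le> exp (ln u / d)"
    using exp_ge_add_one_self[of "ln u / d"] by linarith
  then have "(ln u / d) ^ d \<le> exp (ln u / d) ^ d"
    using assms by (intro power_mono) auto
  also have "\<dots> = u"
    using False assms by (simp add: exp_of_nat_mult[symmetric])
  finally have ln: "ln u ^ d \<le> real d ^ d * u"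
    using False by (simp add: power_divide field_simps)
  have "log 2 u \<le> 2 * ln u"
  proof -
    have "1 / 2 \<le> ln (2 :: real)"
      using ln_le_minus_one[of "1 / 2 :: real"] by (simp add: ln_div)
    then have "ln u * 1 \<le> ln u * (2 * ln 2)" using assms by (intro mult_left_mono) auto
    then show ?thesis by (simp add: log_def field_simps)
  qed
  then have "log 2 u ^ d \<le> (2 * ln u) ^ d"
    using assms by (intro power_mono) auto
  also have "\<dots> \<le> 2 ^ d * (real d ^ d * u)"
    using ln by (simp add: power_mult_distrib)
  finally show ?thesis by (simp add: power_mult_distrib)
qed (use assms in simp)

text \<open>A power of the next logarithm is below a multiple of the current one, so one round
  beyond \<open>a\<close> leaves a single factor \<open>iter_log a\<close>. The factor
  \<open>4 * t\<close> is spent later on making \<open>Z\<close> small against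
  \<open>n / t\<close>.\<close>

lemma iter_log_absorbs_power:
  fixes K d a b :: nat
  assumes "a \<ge> 1"
  shows "\<exists>q. polynomial_fun q \<and> (\<forall>(t :: nat) n :: nat. t \<ge> 1 \<longrightarrow>
    4 * t * (K * (real (b * t) * iter_log (Suc a) n) ^ d) \<le> exp (real (q t)) * iter_log a n)"
proof -
  \<comment> \<open>\<open>8\<close> is \<open>4 * 2\<close>, with the 2 from
    \<open>max 2 L \<le> 2 * L\<close>; the power of \<open>t\<close> becomes the summand
    \<open>Suc d * t\<close> of the exponent through \<open>t \<le> exp t\<close>.\<close>
  define C where "C = 8 * K * b ^ d * (2 * d) ^ d"
  define q where "q t = C + Suc d * t" for t
  have "real (q x) = poly [:real C, real (Suc d):] (real x)" for x
    by (simp add: q_def algebra_simps)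
  then have "polynomial_fun q" unfolding polynomial_fun_def by blast
  moreover have "4 * t * (K * (real (b * t) * iter_log (Suc a) n) ^ d) \<le> exp (real (q t)) * iter_log a n"
    for t n :: nat
  proof -
  define L where "L = iter_log a n"
  obtain a' where "a = Suc a'" using assms by (cases a) auto
  then have L: "L \<ge> 1" by (simp add: L_def le_log_iff)
  have "log 2 (max 2 L) ^ d \<le> (2 * d) ^ d * max 2 L" using log_power_le[of "max 2 L" d] by simp
  also have "\<dots> \<le> (2 * d) ^ d * (2 * L)" using L by (intro mult_left_mono) auto
  finally have log: "log 2 (max 2 L) ^ d \<le> (2 * d) ^ d * (2 * L)" .
  have "4 * t * (K * (real (b * t) * log 2 (max 2 L)) ^ d)
      = 4 * K * real b ^ d * real t ^ Suc d * log 2 (max 2 L) ^ d"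
    by (simp add: power_mult_distrib)
  also have "\<dots> \<le> 4 * K * real b ^ d * real t ^ Suc d * ((2 * d) ^ d * (2 * L))"
    using log by (intro mult_left_mono) auto
  also have "\<dots> = C * real t ^ Suc d * L" by (simp add: C_def)
  also have "\<dots> \<le> exp C * exp t ^ Suc d * L"
  proof -
    have "x \<le> exp x" for x :: real using exp_ge_add_one_self[of x] by linarith
    then show ?thesis using L by (intro mult_right_mono mult_mono power_mono) auto
  qed
  also have "\<dots> = exp (q t) * L"
    by (simp only: q_def exp_of_nat_mult[symmetric] exp_add of_nat_add of_nat_mult)
  finally show ?thesis by (simp add: L_def)
  qed
  ultimately show ?thesis by blast
qed

section \<open>Clique models as shallow minors\<close>

lemma graph_induce_subgraph:
  assumes "graph G" "W \<subseteq> verts G"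
  shows "graph (G \<restriction> W)"
proof -
  interpret graph G by fact
  have ind: "induced_subgraph (G \<restriction> W) G" using assms(2) by (rule induced_induce)
  interpret K: digraph "G \<restriction> W" using ind by (rule digraphI_induced)
  show ?thesis using induced_graph_imp_symmetric[OF sym_arcs ind] by (rule K.graphI)
qed

text \<open>Links balls to library walks. The walk is peeled off at the front while
  \<open>nbhd\<close> grows at the end, hence the detour through \<open>nbhd_add\<close>.\<close>

lemma awalk_imp_nbhd:
  assumes "wf_digraph G" "pre_digraph.awalk (G \<restriction> U) u p v"
  shows "v \<in> nbhd (arcs_ends G) U (length p) {u}"
proof -
  interpret wf_digraph "G \<restriction> U" using assms(1) by (rule wf_digraph.wellformed_induce_subgraph)
  show ?thesis using assms(2)
  proof (induction p arbitrary: u)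
    case (Cons a p)
    have a: "a \<in> arcs G" "tail G a \<in> U" "head G a \<in> U" "u = tail G a"
      and walk: "awalk (head G a) p v"
      using Cons.prems by (auto simp: awalk_Cons_iff)
    have "head G a \<in> nbhd (arcs_ends G) U 1 {u}"
      using a by (auto simp: arcs_ends_conv)
    then have "nbhd (arcs_ends G) U (length p) {head G a} \<subseteq> nbhd (arcs_ends G) U (1 + length p) {u}"
      unfolding nbhd_add by (intro nbhd_mono) auto
    then show ?case using Cons.IH[OF walk] by auto
  qed (auto simp: awalk_Nil_iff)
qed

lemma nbhd_imp_awalk:
  assumes "wf_digraph G" "v \<in> nbhd (arcs_ends G) U k {u}"
  shows "\<exists>p. pre_digraph.awalk (G \<restriction> U) u p v \<and> length p \<le> k"
proof -
  interpret wf_digraph "G \<restriction> U" using assms(1) by (rule wf_digraph.wellformed_induce_subgraph)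
  show ?thesis using assms(2)
  proof (induction k arbitrary: v)
    case 0
    then show ?case by (intro exI[of _ "[]"]) (auto simp: awalk_Nil_iff)
  next
    case (Suc k)
    show ?case
    proof (cases "v \<in> nbhd (arcs_ends G) U k {u}")
      case True
      then show ?thesis using Suc.IH le_SucI by blast
    next
      case False
      then obtain w where w: "w \<in> nbhd (arcs_ends G) U k {u}" "(w, v) \<in> arcs_ends G" "v \<in> U"
        using Suc.prems by auto
      have "w \<in> U" using w(1) nbhd_subset[of _ U k] by blast
      obtain p where p: "awalk u p w" "length p \<le> k" using Suc.IH[OF w(1)] by blast
      obtain a where a: "a \<in> arcs G" "tail G a = w" "head G a = v"
        using w(2) by (auto simp: arcs_ends_conv)
      have "awalk w [a] v" using a w(3) \<open>w \<in> U\<close> by (auto simp: awalk_def)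
      then have "awalk u (p @ [a]) v" using p(1) by (rule awalk_appendI[rotated])
      then show ?thesis using p(2) by (intro exI[of _ "p @ [a]"]) auto
    qed
  qed
qed

lemma (in wf_digraph) awalk_cost_length: "awalk_cost (\<lambda>_. 1) p = real (length p)"
  by (induction p) auto

text \<open>Walk lengths are integers, so every pair is at distance at least \<open>r + 1\<close>;
  unlike a strict bound, this one passes to the infimum.\<close>

lemma graph_setdist_gt:
  assumes "wf_digraph G" "nbhd (arcs_ends G) U r A \<inter> B = {}"
  shows "graph_setdist (G \<restriction> U) A B > ereal (real r)"
proof -
  interpret wf_digraph "G \<restriction> U" using assms(1) by (rule wf_digraph.wellformed_induce_subgraph)
  have "ereal (real (Suc r)) \<le> graph_dist (G \<restriction> U) u v" if uv: "u \<in> A" "v \<in> B" for u v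
    unfolding graph_dist_def \<mu>_def
  proof (rule INF_greatest)
    fix p assume "p \<in> {p. awalk u p v}"
    then have v: "v \<in> nbhd (arcs_ends G) U (length p) {u}"
      using awalk_imp_nbhd[OF assms(1)] by blast
    have "\<not> length p \<le> r"
    proof
      assume "length p \<le> r"
      then have "nbhd (arcs_ends G) U (length p) {u} \<subseteq> nbhd (arcs_ends G) U r A"
        using uv(1) by (intro nbhd_mono) auto
      then show False using v uv(2) assms(2) by blast
    qed
    then show "ereal (real (Suc r)) \<le> ereal (awalk_cost (\<lambda>_. 1) p)"
      by (simp add: awalk_cost_length)
  qed
  then have "ereal (real (Suc r)) \<le> graph_setdist (G \<restriction> U) A B"
    unfolding graph_setdist_def by (intro INF_greatest)
  then show ?thesis by (rule less_le_trans[rotated]) simp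
qed

lemma connected_bag:
  assumes "graph G" "M \<subseteq> verts G" "z \<in> M" "M \<subseteq> nbhd (arcs_ends G) M D {z}"
  shows "Digraph_Component.connected (G \<restriction> M)" "graph_radius (G \<restriction> M) \<le> ereal (real D)"
proof -
  interpret K: graph "G \<restriction> M" using graph_induce_subgraph[OF assms(1,2)] .
  interpret graph G by fact
  have wf: "wf_digraph G" by unfold_locales
  have walk: "\<exists>p. K.awalk z p v \<and> length p \<le> D" if "v \<in> M" for v
    using nbhd_imp_awalk[OF wf] assms(4) that by blast
  have reach: "z \<rightarrow>\<^sup>*\<^bsub>G \<restriction> M\<^esub> v" if "v \<in> M" for v
    using walk[OF that] K.reachable_awalk by blast
  show "Digraph_Component.connected (G \<restriction> M)"
    unfolding connected_def
  proof (rule strongly_connectedI)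
    fix u v assume "u \<in> verts (with_proj (mk_symmetric (G \<restriction> M)))"
      "v \<in> verts (with_proj (mk_symmetric (G \<restriction> M)))"
    then have uv: "u \<in> M" "v \<in> M" by auto
    have "u \<rightarrow>\<^sup>*\<^bsub>G \<restriction> M\<^esub> z" using symmetric_reachable[OF K.sym_arcs reach[OF uv(1)]] .
    then have "u \<rightarrow>\<^sup>*\<^bsub>G \<restriction> M\<^esub> v" using reach[OF uv(2)] by (rule K.reachable_trans)
    then show "u \<rightarrow>\<^sup>*\<^bsub>with_proj (mk_symmetric (G \<restriction> M))\<^esub> v"
      by (rule K.reachable_mk_symmetricI)
  qed (use assms(3) in auto)
  have "graph_dist (G \<restriction> M) z v \<le> ereal (real D)" if v: "v \<in> M" for v
  proof -
    obtain p where p: "K.awalk z p v" "length p \<le> D" using walk[OF v] by blast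
    have "K.\<mu> (\<lambda>_. 1) z v \<le> ereal (K.awalk_cost (\<lambda>_. 1) p)"
      using K.min_cost_le_walk_cost[OF p(1)] .
    also have "\<dots> \<le> ereal (real D)" using p(2) by (simp add: K.awalk_cost_length)
    finally show ?thesis by (simp add: graph_dist_def)
  qed
  then show "graph_radius (G \<restriction> M) \<le> ereal (real D)"
    unfolding graph_radius_def using assms(3) by (intro INF_lower2[of z] SUP_least) auto
qed

text \<open>Makes \<open>nabla\<close> a genuine maximum: a minor is determined by a family of
  subsets of \<open>verts G\<close> and a relation between them.\<close>

lemma finite_depth_minors:
  assumes "graph G"
  shows "finite {H. depth_minor l G H}"
proof (rule finite_subset)
  interpret graph G by fact
  let ?mk = "\<lambda>(P, A). \<lparr>pverts = P, parcs = A\<rparr> :: 'a set pair_pre_digraph"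
  show "finite (?mk ` (Pow (Pow (verts G)) \<times> Pow (Pow (verts G) \<times> Pow (verts G))))"
    by simp
  show "{H. depth_minor l G H} \<subseteq> ?mk ` (Pow (Pow (verts G)) \<times> Pow (Pow (verts G) \<times> Pow (verts G)))"
  proof
    fix H assume "H \<in> {H. depth_minor l G H}"
    then obtain S F where SF: "subgraph S G" "\<forall>K\<in>F. subgraph K S" "H = contract S F"
      unfolding depth_minor_def by blast
    have "verts S \<subseteq> verts G" using SF(1) by (rule subgraph_imp_subverts)
    moreover have "verts K \<subseteq> verts S" if "K \<in> F" for K
      using SF(2) that by (intro subgraph_imp_subverts) auto
    ultimately have P: "pverts H \<subseteq> Pow (verts G)"
      unfolding SF(3) contract_def Let_def by auto
    have "parcs H \<subseteq> pverts H \<times> pverts H"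
      unfolding SF(3) contract_def Let_def by auto
    then have "parcs H \<subseteq> Pow (verts G) \<times> Pow (verts G)" using P by blast
    then show "H \<in> ?mk ` (Pow (Pow (verts G)) \<times> Pow (Pow (verts G) \<times> Pow (verts G)))"
      using P by (intro image_eqI[of _ _ "(pverts H, parcs H)"]) auto
  qed
qed

text \<open>Contract the bags inside the subgraph induced on their union; no vertex lies outside all
  bags, so exactly the complete graph on the bags arises.\<close>

lemma clique_model_depth_minor:
  assumes G: "graph G" and model: "clique_model (arcs_ends G) (verts G) D \<M>"
  shows "depth_minor D G \<lparr>pverts = \<M>, parcs = {(M, L). M \<in> \<M> \<and> L \<in> \<M> \<and> M \<noteq> L}\<rparr>"
proof -
  interpret graph G by fact
  define S where "S = G \<restriction> \<Union>\<M>"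
  define F where "F = (\<lambda>M. G \<restriction> M) ` \<M>"
  have bag: "M \<subseteq> verts G" if "M \<in> \<M>" for M
    using model that by (simp add: clique_model_def)
  then have sub: "\<Union>\<M> \<subseteq> verts G" by (rule Union_least)
  have S: "graph S" "subgraph S G"
    using graph_induce_subgraph[OF G sub] subgraph_induce_subgraphI[OF sub] by (simp_all add: S_def)
  have F: "graph K \<and> subgraph K S \<and> Digraph_Component.connected K \<and>
      graph_radius K \<le> ereal (real D)" if K: "K \<in> F" for K
  proof -
    obtain M where M: "M \<in> \<M>" "K = G \<restriction> M" using K by (auto simp: F_def)
    have "\<exists>z\<in>M. M \<subseteq> nbhd (arcs_ends G) M D {z}"
      using model M(1) by (simp add: clique_model_def)
    then obtain z where z: "z \<in> M" "M \<subseteq> nbhd (arcs_ends G) M D {z}" by blast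
    have "subgraph (G \<restriction> M) S"
    proof (rule subgraphI)
      show "verts (G \<restriction> M) \<subseteq> verts S" "arcs (G \<restriction> M) \<subseteq> arcs S"
        using M(1) by (auto simp: S_def)
      show "compatible S (G \<restriction> M)" by (simp add: compatible_def S_def)
      show "wf_digraph (G \<restriction> M)" "wf_digraph S"
        unfolding S_def by (rule wellformed_induce_subgraph)+
    qed
    then show ?thesis
      unfolding M(2) by (intro conjI connected_bag[OF G bag[OF M(1)] z]
          graph_induce_subgraph[OF G bag[OF M(1)]])
  qed
  have disj: "pairwise (\<lambda>K L. disjnt (verts K) (verts L)) F"
  proof (rule pairwiseI)
    fix K L assume KL: "K \<in> F" "L \<in> F" "K \<noteq> L"
    then obtain M M' where "M \<in> \<M>" "M' \<in> \<M>" "K = G \<restriction> M" "L = G \<restriction> M'"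
      by (auto simp: F_def)
    moreover have "M \<noteq> M'" using KL(3) calculation by blast
    ultimately show "disjnt (verts K) (verts L)"
      using model by (simp add: clique_model_def disjnt_def)
  qed
  have eq: "\<lparr>pverts = \<M>, parcs = {(M, L). M \<in> \<M> \<and> L \<in> \<M> \<and> M \<noteq> L}\<rparr> = contract S F"
  proof -
    have V: "verts ` F \<union> (\<lambda>v. {v}) ` (verts S - (\<Union>K\<in>F. verts K)) = \<M>"
      by (auto simp: F_def S_def image_image)
    have "\<exists>u\<in>M. \<exists>v\<in>L. u \<rightarrow>\<^bsub>S\<^esub> v" if bags: "M \<in> \<M>" "L \<in> \<M>" "M \<noteq> L" for M L
    proof -
      have "arcs_ends G `` M \<inter> L \<noteq> {}" using model bags by (simp add: clique_model_def)
      then obtain u v where uv: "u \<in> M" "v \<in> L" "(u, v) \<in> arcs_ends G" by blast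
      moreover obtain a where "a \<in> arcs G" "tail G a = u" "head G a = v"
        using uv(3) by (auto simp: arcs_ends_conv)
      then have "a \<in> arcs S" "tail S a = u" "head S a = v"
        using uv(1,2) bags by (auto simp: S_def)
      then have "(u, v) \<in> arcs_ends S" by (auto simp: arcs_ends_conv)
      ultimately show ?thesis by blast
    qed
    then have "{(X, Y). X \<in> \<M> \<and> Y \<in> \<M> \<and> X \<noteq> Y \<and> (\<exists>u\<in>X. \<exists>v\<in>Y. u \<rightarrow>\<^bsub>S\<^esub> v)} =
        {(M, L). M \<in> \<M> \<and> L \<in> \<M> \<and> M \<noteq> L}"
      by blast
    then show ?thesis unfolding contract_def V Let_def by simp
  qed
  show ?thesis
    unfolding depth_minor_def eq
  proof (rule exI[of _ S], rule exI[of _ F], intro conjI)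
    show "\<forall>K\<in>F. graph K \<and> subgraph K S \<and> Digraph_Component.connected K \<and>
        graph_radius K \<le> ereal (real D)"
      by (rule ballI) (rule F)
  qed (rule S disj refl)+
qed

text \<open>The complete graph on \<open>k\<close> vertices has density \<open>(k - 1) / 2\<close>,
  which the expansion bounds by \<open>p D\<close>.\<close>

lemma clique_model_card_le:
  assumes G: "graph G" and exp: "expansion_bounded G (\<lambda>l. real (p l))"
    and model: "clique_model (arcs_ends G) (verts G) D \<M>"
  shows "card \<M> \<le> 2 * p D + 1"
proof (cases "card \<M> = 0")
  case False
  define H where "H = \<lparr>pverts = \<M>, parcs = {(M, L). M \<in> \<M> \<and> L \<in> \<M> \<and> M \<noteq> L}\<rparr>"
  have fin: "finite \<M>" by (rule ccontr) (use False in simp)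
  have "parcs H = \<M> \<times> \<M> - (\<lambda>M. (M, M)) ` \<M>" by (auto simp: H_def)
  moreover have "card (\<M> \<times> \<M> - (\<lambda>M. (M, M)) ` \<M>) = card (\<M> \<times> \<M>) - card ((\<lambda>M. (M, M)) ` \<M>)"
    using fin by (intro card_Diff_subset) auto
  moreover have "card ((\<lambda>M. (M, M)) ` \<M>) = card \<M>" by (intro card_image inj_onI) auto
  ultimately have "card (parcs H) = card \<M> * card \<M> - card \<M>"
    by (simp only: card_cartesian_product)
  moreover have "card \<M> \<le> card \<M> * card \<M>" using False by simp
  ultimately have arcs: "real (card (parcs H)) = real (card \<M>) * real (card \<M>) - real (card \<M>)"
    by (simp only: of_nat_diff of_nat_mult)
  have verts: "pverts H = \<M>" by (simp add: H_def)
  have "edge_density H = (real (card \<M>) - 1) / 2"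
    using False unfolding edge_density_def arcs verts by (simp add: field_simps)
  moreover have "edge_density H \<le> nabla D G"
    unfolding nabla_def H_def
    by (rule Max_ge[OF finite_imageI[OF finite_depth_minors[OF G]]])
      (rule imageI, rule CollectI, rule clique_model_depth_minor[OF G model])
  moreover have "nabla D G \<le> real (p D)" using exp by (simp add: expansion_bounded_def)
  ultimately have "real (card \<M>) \<le> real (2 * p D + 1)"
    unfolding of_nat_add of_nat_mult by simp
  then show ?thesis by (simp only: of_nat_le_iff)
qed simp

text \<open>Moving \<open>|Z|\<close> vertices from each side to the separator makes the balance relative to \<open>V - Z\<close>.\<close>

lemma trim_separation:
  assumes wf: "wf_digraph G" and fin: "finite (verts G)"
    and sep: "dist_separation (arcs_ends G) (verts G) r Z X A B"
  shows "\<exists>C. balanced_dist_separator r (delete_verts G Z) C \<and> card C \<le> card X + 2 * card Z"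
proof -
  define U where "U = verts G - Z"
  have AB: "A \<union> B = U - X" "A \<inter> B = {}" "3 * card A \<le> 2 * card (verts G)"
    "3 * card B \<le> 2 * card (verts G)" "nbhd (arcs_ends G) U r A \<inter> B = {}"
    and Z: "Z \<subseteq> verts G" and X: "X \<subseteq> verts G"
    using sep by (auto simp: dist_separation_def U_def)
  have "A \<subseteq> verts G" "B \<subseteq> verts G" using AB(1) by (auto simp: U_def)
  then have finAB: "finite A" "finite B" "finite X" "finite Z"
    using X Z fin by (simp_all add: finite_subset)
  have card_U: "card U + card Z = card (verts G)"
    using card_Diff_subset[OF finAB(4) Z] card_mono[OF fin Z] by (simp add: U_def)
  \<comment> \<open>Subtraction truncates: a side with fewer than \<open>card Z\<close> vertices is
    moved entirely.\<close>
  obtain A' where A': "A' \<subseteq> A" "card A' = card A - card Z"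
    using obtain_subset_with_card_n[of "card A - card Z" A] by auto
  obtain B' where B': "B' \<subseteq> B" "card B' = card B - card Z"
    using obtain_subset_with_card_n[of "card B - card Z" B] by auto
  define C where "C = U - (A' \<union> B')"
  have "C \<subseteq> X \<union> ((A - A') \<union> (B - B'))" using AB(1) by (auto simp: C_def)
  then have "card C \<le> card (X \<union> ((A - A') \<union> (B - B')))"
    using finAB by (intro card_mono) auto
  also have "\<dots> \<le> card X + (card (A - A') + card (B - B'))"
    by (intro order.trans[OF card_Un_le] add_left_mono card_Un_le)
  also have "card (A - A') = card A - card A'"
    using A'(1) finite_subset[OF A'(1) finAB(1)] by (intro card_Diff_subset)
  also have "card (B - B') = card B - card B'"
    using B'(1) finite_subset[OF B'(1) finAB(2)] by (intro card_Diff_subset)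
  finally have "card C \<le> card X + 2 * card Z" using A'(2) B'(2) by linarith
  moreover have "balanced_dist_separator r (delete_verts G Z) C"
    unfolding balanced_dist_separator_def
  proof (intro conjI exI)
    show "C \<subseteq> verts (delete_verts G Z)" by (auto simp: C_def U_def)
    show "verts (delete_verts (delete_verts G Z) C) = A' \<union> B'"
      using A'(1) B'(1) AB(1) by (auto simp: C_def U_def)
    show "A' \<inter> B' = {}" using A'(1) B'(1) AB(2) by blast
    have "3 * card A' \<le> 2 * card U" using A'(2) AB(3) card_U by linarith
    then show "real (card A') \<le> 2 / 3 * real (card (verts (delete_verts G Z)))"
      by (simp add: U_def)
    have "3 * card B' \<le> 2 * card U" using B'(2) AB(4) card_U by linarith
    then show "real (card B') \<le> 2 / 3 * real (card (verts (delete_verts G Z)))"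
      by (simp add: U_def)
    have "nbhd (arcs_ends G) U r A' \<inter> B' = {}"
      using AB(5) A'(1) B'(1) nbhd_mono[of U U r r A' A "arcs_ends G"] by blast
    then show "graph_setdist (delete_verts G Z) A' B' > ereal (real r)"
      using graph_setdist_gt[OF wf] by (simp add: U_def)
  qed
  ultimately show ?thesis by blast
qed

theorem theorem7:
  fixes p :: "nat \<Rightarrow> nat" and a r :: nat
  assumes "polynomial_fun p" and "a \<ge> 1" and "r \<ge> 1"
  shows "\<exists>q' :: nat \<Rightarrow> nat. polynomial_fun q' \<and>
    (\<forall>G :: ('a, 'b) pre_digraph. \<forall>n.
      graph G \<and> card (verts G) = n \<and> expansion_bounded G (\<lambda>l. real (p l)) \<longrightarrow>
      (\<forall>t :: nat. t \<ge> 1 \<longrightarrow>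
        (\<exists>Z. Z \<subseteq> verts G \<and>
          real (card Z) \<le> exp (real (q' t)) * iter_log a (real n) \<and>
          (\<exists>C. balanced_dist_separator r (delete_verts G Z) C \<and>
            real (card C) \<le> real n / real t))))"
proof -
  obtain c e :: nat where p: "\<And>x. p x \<le> c * Suc x ^ e"
    using polynomial_fun_bound[OF assms(1)] by blast
  \<comment> \<open>\<open>Suc a\<close> rounds: the additional logarithm serves to absorb the
    exponent \<open>d\<close>.\<close>
  obtain K d :: nat where sep: "\<forall>(E :: 'a rel) V N.
    finite V \<and> V \<noteq> {} \<and> sym E \<and> N > 0 \<and>
    (\<forall>D \<M>. clique_model E V D \<M> \<longrightarrow> card \<M> \<le> 2 * p D + 1) \<longrightarrow>
    (\<exists>Z X A B. dist_separation E V r Z X A B \<and> N * card X \<le> 2 * Suc a * card V \<and>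
      real (card Z) \<le> real K * (real N * iter_log (Suc a) (card V)) ^ d)"
    using iterated_separation[of p c e r "Suc a", OF p] by (elim exE conjE) (rule that)
  obtain q where q: "polynomial_fun q" "\<And>t n :: nat. t \<ge> 1 \<Longrightarrow>
      real (4 * t) * (real K * (real (4 * Suc a * t) * iter_log (Suc a) (real n)) ^ d)
      \<le> exp (real (q t)) * iter_log a (real n)"
    using iter_log_absorbs_power[OF assms(2), of K "4 * Suc a" d] by auto
  have "\<exists>Z. Z \<subseteq> verts G \<and> real (card Z) \<le> exp (real (q t)) * iter_log a (real (card (verts G))) \<and>
      (\<exists>C. balanced_dist_separator r (delete_verts G Z) C \<and>
        real (card C) \<le> real (card (verts G)) / real t)"
    if G: "graph G" and exp: "expansion_bounded G (\<lambda>l. real (p l))" and t: "t \<ge> 1"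
    for G :: "('a, 'b) pre_digraph" and t :: nat
  proof -
    interpret graph G by fact
    have wf: "wf_digraph G" by unfold_locales
    define n where "n = card (verts G)"
    show ?thesis
    \<comment> \<open>If the bound is at least \<open>n\<close>, deleting all vertices works; the
      two empty sides are at infinite distance.\<close>
    proof (cases "real n \<le> exp (real (q t)) * iter_log a (real n)")
      case True
      have "balanced_dist_separator r (delete_verts G (verts G)) {}"
        by (auto simp: balanced_dist_separator_def graph_setdist_def top_ereal_def)
      then show ?thesis using True by (intro exI[of _ "verts G"] conjI exI[of _ "{}"]) (auto simp: n_def)
    next
      case False
      \<comment> \<open>Chosen so that \<open>N * card X \<le> 2 * Suc a * n\<close> becomes
        \<open>card X \<le> n / (2 * t)\<close>.\<close>
      define N where "N = 4 * Suc a * t"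
      have "iter_log a (real n) \<ge> 0"
      proof -
        obtain a' where "a = Suc a'" using assms(2) by (cases a) auto
        then show ?thesis by (simp add: zero_le_log_cancel_iff)
      qed
      then have "verts G \<noteq> {}" using False by (auto simp: n_def)
      then have "finite (verts G) \<and> verts G \<noteq> {} \<and> sym (arcs_ends G) \<and> N > 0 \<and>
          (\<forall>D \<M>. clique_model (arcs_ends G) (verts G) D \<M> \<longrightarrow> card \<M> \<le> 2 * p D + 1)"
        using t sym_arcs clique_model_card_le[OF G exp] by (auto simp: N_def symmetric_def)
      from sep[rule_format, OF this] obtain Z X A B
        where sep: "dist_separation (arcs_ends G) (verts G) r Z X A B"
          and X: "N * card X \<le> 2 * Suc a * n"
          and Z: "real (card Z) \<le> real K * (real N * iter_log (Suc a) n) ^ d"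
        unfolding n_def[symmetric] by (elim exE conjE) (rule that)
      have "real (4 * t) * real (card Z)
          \<le> real (4 * t) * (real K * (real N * iter_log (Suc a) n) ^ d)"
        using Z by (intro mult_left_mono) auto
      also have "\<dots> \<le> exp (real (q t)) * iter_log a (real n)"
        unfolding N_def by (rule q(2)[OF t])
      finally have tZ: "real (4 * t) * real (card Z) \<le> exp (real (q t)) * iter_log a (real n)" .
      \<comment> \<open>Failure of the first case turns the bound on \<open>Z\<close> into
        \<open>4 * t * card Z \<le> n\<close>, so the vertices trimmed from both sides number at
        most \<open>n / (2 * t)\<close>.\<close>
      then have "real (4 * t * card Z) \<le> real n" using False by simp
      then have "4 * t * card Z \<le> n" by (simp only: of_nat_le_iff)
      moreover have "2 * t * card X \<le> n"
      proof -
        have "2 * Suc a * (2 * t * card X) \<le> 2 * Suc a * n"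
          using X by (simp add: N_def algebra_simps)
        then show ?thesis by (simp only: mult_le_cancel1) simp
      qed
      moreover obtain C where C: "balanced_dist_separator r (delete_verts G Z) C"
        "card C \<le> card X + 2 * card Z"
        using trim_separation[OF wf finite_verts sep] by blast
      have "t * card C \<le> t * (card X + 2 * card Z)" using C(2) by (rule mult_le_mono2)
      ultimately have "t * card C \<le> n" by (simp add: distrib_left)
      then have "real (t * card C) \<le> real n" by (simp only: of_nat_le_iff)
      then have "real (card C) \<le> real n / real t" using t by (simp add: field_simps)
      moreover have "1 * real (card Z) \<le> real (4 * t) * real (card Z)"
        using t by (intro mult_right_mono) auto
      then have "real (card Z) \<le> exp (real (q t)) * iter_log a (real n)" using tZ by linarith
      moreover have "Z \<subseteq> verts G" using sep by (simp add: dist_separation_def)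
      ultimately show ?thesis using C(1) unfolding n_def by blast
    qed
  qed
  then show ?thesis using q(1) by blast
qed

end
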